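(* Let $E$ be an energy form of full support on $L^0(m)$. The following assertions are equivalent. (i) $E$ is recurrent. (ii) Every $E$-excessive function belongs to $\ker E$. If, additionally, $E$ is irreducible and $D(E)$ contains a nonconstant function, then both assertions are equivalent to the following. (iii) Every $E$-excessive function is constant.
   Context: $(X,\mathcal B,m)$ is a measure space with $m$ localizable: $m$ is semi-finite and every family $\mathcal A\subseteq\mathcal B$ has an essential supremum $S\in\mathcal B$, i.e. $m(A\setminus S)=0$ for all $A\in\mathcal A$, and $m(S\setminus G)=0$ whenever $G\in\mathcal B$ satisfies $m(A\setminus G)=0$ for all $A\in\mathcal A$. $L^0(m)$ is the space of real-valued measurable functions modulo $m$-a.e. equality, with the topology $\tau(m)$ of local convergence in measure: $f_i\to f$ iff $\int_U|f_i-f|\wedge1\,dm\to0$ for every measurable $U$ with $m(U)<\infty$. A quadratic form on $L^0(m)$ is a map $q:L^0(m)\to[0,\infty]$ with $2q(u)+2q(v)=q(u+v)+q(u-v)$ and $q(\lambda u)=|\lambda|^2q(u)$ ($0\cdot\infty=0$); $D(q)=\{q<\infty\}$, $\ker q=\{q=0\}$, and $q(u,v)=\frac14(q(u+v)-q(u-v))$ is the induced bilinear form on $D(q)$. It is closed if $D(q)$ is complete in the form topology, the smallest topology containing the subspace topology of $\tau(m)$ and the topology of the seminorm $q^{1/2}$. An $\varepsilon$-cutoff is a monotone increasing map $C:\mathbb R\to[-\varepsilon,1+\varepsilon]$ with $|C(x)-C(y)|\le|x-y|$ and $C(x)=x$ for $x\in[0,1]$. A quadratic form $E$ on $L^0(m)$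 is Markovian if for each $\varepsilon>0$ there is an $\varepsilon$-cutoff $C_\varepsilon$ with $E(C_\varepsilon\circ f)\le E(f)$ for all $f\in L^0(m)$; an energy form is a closed Markovian form on $L^0(m)$. $E$ is recurrent if $1\in\ker E$. A function $h\in D(E)$ is $E$-superharmonic if $E(h,\psi)\ge0$ for all nonnegative $\psi\in D(E)$; a function in $L^0(m)$ is $E$-excessive if it belongs to the $\tau(m)$-closure of the set of $E$-superharmonic functions. $E$ has full support if $X$ is an essential supremum of $\{\{|f|\ge\alpha\}: f\in D(E),\ \alpha>0\}$. A measurable set $A$ is $E$-invariant if $E(f)=E(1_Af)+E(1_{X\setminus A}f)$ for all $f\in D(E)$; $E$ is irreducible if every $E$-invariant $A$ satisfies $m(A)=0$ or $m(X\setminus A)=0$. Constant means $m$-a.e. equal to a constant. *)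

theory Defs
  imports "HOL-Analysis.Analysis"
begin

text \<open>
  Elements of \<open>L\<^sup>0(m)\<close> are represented by measurable functions; maps on \<open>L\<^sup>0(m)\<close> are maps on
  representatives that respect almost-everywhere equality (see \<open>quadratic_form\<close>). The topologies
  below live on representatives and are accordingly not Hausdorff: functions that agree
  almost everywhere are topologically indistinguishable.
\<close>

definition L0 :: "'a measure \<Rightarrow> ('a \<Rightarrow> real) set" where
  "L0 M = borel_measurable M"

definition ess_supremum :: "'a measure \<Rightarrow> 'a set set \<Rightarrow> 'a set \<Rightarrow> bool" where
  "ess_supremum M \<A> S \<longleftrightarrow> S \<in> sets M \<and>
     (\<forall>A\<in>\<A>. emeasure M (A - S) = 0) \<and>
     (\<forall>G\<in>sets M. (\<forall>A\<in>\<A>. emeasure M (A - G) = 0) \<longrightarrow> emeasure M (S - G) = 0)"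

text \<open>
  The locale \<open>semifinite_measure\<close> of the library does not require \<open>0 < emeasure M B\<close> and is
  therefore satisfied by every measure.
\<close>

definition semi_finite :: "'a measure \<Rightarrow> bool" where
  "semi_finite M \<longleftrightarrow>
     (\<forall>A\<in>sets M. emeasure M A = \<infinity> \<longrightarrow>
        (\<exists>B\<in>sets M. B \<subseteq> A \<and> 0 < emeasure M B \<and> emeasure M B < \<infinity>))"

definition localizable :: "'a measure \<Rightarrow> bool" where
  "localizable M \<longleftrightarrow> semi_finite M \<and> (\<forall>\<A>\<subseteq>sets M. \<exists>S. ess_supremum M \<A> S)"

definition meas_dist :: "'a measure \<Rightarrow> 'a set \<Rightarrow> ('a \<Rightarrow> real) \<Rightarrow> ('a \<Rightarrow> real) \<Rightarrow> ennreal" where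
  "meas_dist M U f g = (\<integral>\<^sup>+x\<in>U. ennreal (min \<bar>f x - g x\<bar> 1) \<partial>M)"

definition tau :: "'a measure \<Rightarrow> ('a \<Rightarrow> real) topology" where
  "tau M = topology_generated_by
     {{g \<in> L0 M. meas_dist M U g f < ennreal r} | U f r.
        U \<in> sets M \<and> emeasure M U < \<infinity> \<and> f \<in> L0 M \<and> 0 < r}"

definition quadratic_form :: "'a measure \<Rightarrow> (('a \<Rightarrow> real) \<Rightarrow> ennreal) \<Rightarrow> bool" where
  "quadratic_form M q \<longleftrightarrow>
     (\<forall>f\<in>L0 M. \<forall>g\<in>L0 M. (AE x in M. f x = g x) \<longrightarrow> q f = q g) \<and>
     (\<forall>u\<in>L0 M. \<forall>v\<in>L0 M.
        2 * q u + 2 * q v = q (\<lambda>x. u x + v x) + q (\<lambda>x. u x - v x)) \<and>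
     (\<forall>u\<in>L0 M. \<forall>c::real. q (\<lambda>x. c * u x) = ennreal (\<bar>c\<bar>\<^sup>2) * q u)"

definition form_domain :: "'a measure \<Rightarrow> (('a \<Rightarrow> real) \<Rightarrow> ennreal) \<Rightarrow> ('a \<Rightarrow> real) set" where
  "form_domain M q = {f \<in> L0 M. q f < \<infinity>}"

definition form_kernel :: "'a measure \<Rightarrow> (('a \<Rightarrow> real) \<Rightarrow> ennreal) \<Rightarrow> ('a \<Rightarrow> real) set" where
  "form_kernel M q = {f \<in> L0 M. q f = 0}"

text \<open>Only meaningful for arguments in the form domain.\<close>

definition bilin :: "(('a \<Rightarrow> real) \<Rightarrow> ennreal) \<Rightarrow> ('a \<Rightarrow> real) \<Rightarrow> ('a \<Rightarrow> real) \<Rightarrow> real" where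
  "bilin q u v =
     (enn2real (q (\<lambda>x. u x + v x)) - enn2real (q (\<lambda>x. u x - v x))) / 4"

definition seminorm_topology ::
    "'a measure \<Rightarrow> (('a \<Rightarrow> real) \<Rightarrow> ennreal) \<Rightarrow> ('a \<Rightarrow> real) topology" where
  "seminorm_topology M q = topology_generated_by
     {{g \<in> form_domain M q. sqrt (enn2real (q (\<lambda>x. g x - f x))) < r} | f r.
        f \<in> form_domain M q \<and> 0 < r}"

definition form_topology ::
    "'a measure \<Rightarrow> (('a \<Rightarrow> real) \<Rightarrow> ennreal) \<Rightarrow> ('a \<Rightarrow> real) topology" where
  "form_topology M q = topology_generated_by
     ({W. openin (subtopology (tau M) (form_domain M q)) W} \<union>
      {W. openin (seminorm_topology M q) W})"

text \<open>
  Completeness of a vector space of functions with a (possibly non-metrizable) vector space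
  topology: every Cauchy filter on the space converges, where Cauchy refers to the uniformity
  given by the neighbourhoods of \<open>0\<close>.
\<close>

definition cauchy_filter_in :: "('a \<Rightarrow> real) topology \<Rightarrow> ('a \<Rightarrow> real) filter \<Rightarrow> bool" where
  "cauchy_filter_in T F \<longleftrightarrow>
     (\<forall>W. openin T W \<and> (\<lambda>x. 0) \<in> W \<longrightarrow>
        (\<forall>\<^sub>F (f, g) in F \<times>\<^sub>F F. (\<lambda>x. f x - g x) \<in> W))"

definition vs_complete :: "('a \<Rightarrow> real) topology \<Rightarrow> bool" where
  "vs_complete T \<longleftrightarrow>
     (\<forall>F. F \<noteq> bot \<and> F \<le> principal (topspace T) \<and> cauchy_filter_in T F \<longrightarrow>
        (\<exists>f. limitin T (\<lambda>g. g) f F))"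

definition closed_form :: "'a measure \<Rightarrow> (('a \<Rightarrow> real) \<Rightarrow> ennreal) \<Rightarrow> bool" where
  "closed_form M q \<longleftrightarrow> vs_complete (form_topology M q)"

definition cutoff :: "real \<Rightarrow> (real \<Rightarrow> real) \<Rightarrow> bool" where
  "cutoff \<epsilon> C \<longleftrightarrow> mono C \<and> range C \<subseteq> {-\<epsilon>..1 + \<epsilon>} \<and>
     (\<forall>x y. \<bar>C x - C y\<bar> \<le> \<bar>x - y\<bar>) \<and> (\<forall>x\<in>{0..1}. C x = x)"

definition markovian :: "'a measure \<Rightarrow> (('a \<Rightarrow> real) \<Rightarrow> ennreal) \<Rightarrow> bool" where
  "markovian M E \<longleftrightarrow>
     (\<forall>\<epsilon>>0. \<exists>C. cutoff \<epsilon> C \<and> (\<forall>f\<in>L0 M. E (C \<circ> f) \<le> E f))"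

definition energy_form :: "'a measure \<Rightarrow> (('a \<Rightarrow> real) \<Rightarrow> ennreal) \<Rightarrow> bool" where
  "energy_form M E \<longleftrightarrow> quadratic_form M E \<and> closed_form M E \<and> markovian M E"

definition recurrent :: "'a measure \<Rightarrow> (('a \<Rightarrow> real) \<Rightarrow> ennreal) \<Rightarrow> bool" where
  "recurrent M E \<longleftrightarrow> (\<lambda>x. 1) \<in> form_kernel M E"

definition superharmonic ::
    "'a measure \<Rightarrow> (('a \<Rightarrow> real) \<Rightarrow> ennreal) \<Rightarrow> ('a \<Rightarrow> real) \<Rightarrow> bool" where
  "superharmonic M E h \<longleftrightarrow> h \<in> form_domain M E \<and>
     (\<forall>\<psi>\<in>form_domain M E. (AE x in M. 0 \<le> \<psi> x) \<longrightarrow> 0 \<le> bilin E h \<psi>)"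

definition excessive ::
    "'a measure \<Rightarrow> (('a \<Rightarrow> real) \<Rightarrow> ennreal) \<Rightarrow> ('a \<Rightarrow> real) \<Rightarrow> bool" where
  "excessive M E h \<longleftrightarrow> h \<in> tau M closure_of {u. superharmonic M E u}"

definition full_support :: "'a measure \<Rightarrow> (('a \<Rightarrow> real) \<Rightarrow> ennreal) \<Rightarrow> bool" where
  "full_support M E \<longleftrightarrow>
     ess_supremum M
       {{x \<in> space M. \<alpha> \<le> \<bar>f x\<bar>} | f \<alpha>. f \<in> form_domain M E \<and> 0 < \<alpha>} (space M)"

definition form_invariant ::
    "'a measure \<Rightarrow> (('a \<Rightarrow> real) \<Rightarrow> ennreal) \<Rightarrow> 'a set \<Rightarrow> bool" where
  "form_invariant M E A \<longleftrightarrow> A \<in> sets M \<and>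
     (\<forall>f\<in>form_domain M E.
        E f = E (\<lambda>x. indicator A x * f x) + E (\<lambda>x. indicator (space M - A) x * f x))"

definition irreducible_form :: "'a measure \<Rightarrow> (('a \<Rightarrow> real) \<Rightarrow> ennreal) \<Rightarrow> bool" where
  "irreducible_form M E \<longleftrightarrow>
     (\<forall>A. form_invariant M E A \<longrightarrow> emeasure M A = 0 \<or> emeasure M (space M - A) = 0)"

definition ae_constant :: "'a measure \<Rightarrow> ('a \<Rightarrow> real) \<Rightarrow> bool" where
  "ae_constant M f \<longleftrightarrow> (\<exists>c. AE x in M. f x = c)"

subsection \<open>Convergence in \<open>tau\<close>\<close>

lemma meas_dist_triangle:
  assumes "U \<in> sets M" "f \<in> L0 M" "g \<in> L0 M" "h \<in> L0 M"
  shows "meas_dist M U f h \<le> meas_dist M U f g + meas_dist M U g h"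
proof -
  have [measurable]: "U \<in> sets M" "f \<in> borel_measurable M" "g \<in> borel_measurable M"
      "h \<in> borel_measurable M"
    using assms by (auto simp: L0_def)
  have "meas_dist M U f h
      \<le> (\<integral>\<^sup>+x. (ennreal (min \<bar>f x - g x\<bar> 1) * indicator U x
               + ennreal (min \<bar>g x - h x\<bar> 1) * indicator U x) \<partial>M)"
    unfolding meas_dist_def
    by (intro nn_integral_mono)
      (auto simp: indicator_def ennreal_plus[symmetric] simp del: ennreal_plus intro!: ennreal_leI)
  also have "\<dots> = meas_dist M U f g + meas_dist M U g h"
    unfolding meas_dist_def by (rule nn_integral_add) measurable
  finally show ?thesis .
qed

lemma meas_dist_self: "meas_dist M U f f = 0"
  by (simp add: meas_dist_def)

lemma topspace_tau: "topspace (tau M) = L0 M"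
proof -
  have "g \<in> \<Union>{{g \<in> L0 M. meas_dist M U g f < ennreal r} | U f r.
        U \<in> sets M \<and> emeasure M U < \<infinity> \<and> f \<in> L0 M \<and> 0 < r}" if "g \<in> L0 M" for g
    using that
    by (intro UnionI[of "{h \<in> L0 M. meas_dist M {} h g < ennreal 1}"] CollectI exI[of _ "{}"]
          exI[of _ g] exI[of _ 1]) (auto simp: meas_dist_self)
  then show ?thesis
    unfolding tau_def topology_generated_by_topspace by auto
qed

theorem limitin_tau_iff:
  assumes "\<And>i. f i \<in> L0 M" and g: "g \<in> L0 M"
  shows "limitin (tau M) f g F \<longleftrightarrow>
    (\<forall>U\<in>sets M. emeasure M U < \<infinity> \<longrightarrow> ((\<lambda>i. meas_dist M U (f i) g) \<longlongrightarrow> 0) F)"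
proof
  assume L: "limitin (tau M) f g F"
  show "\<forall>U\<in>sets M. emeasure M U < \<infinity> \<longrightarrow> ((\<lambda>i. meas_dist M U (f i) g) \<longlongrightarrow> 0) F"
  proof (intro ballI impI order_tendstoI)
    fix U and e :: ennreal
    assume U: "U \<in> sets M" "emeasure M U < \<infinity>" and "0 < e"
    then obtain y where y: "0 < y" "y < e"
      using dense by blast
    then obtain r where r: "0 < r" "ennreal r < e"
      by (cases y) auto
    let ?B = "{h \<in> L0 M. meas_dist M U h g < ennreal r}"
    have "openin (tau M) ?B"
      unfolding tau_def using U g r by (intro topology_generated_by_Basis) blast
    moreover have "g \<in> ?B"
      using g r by (simp add: meas_dist_self)
    ultimately have "\<forall>\<^sub>F i in F. f i \<in> ?B"
      using L by (simp only: limitin_def)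
    then show "\<forall>\<^sub>F i in F. meas_dist M U (f i) g < e"
      using r by (auto elim: eventually_mono)
  qed simp
next
  assume R: "\<forall>U\<in>sets M. emeasure M U < \<infinity> \<longrightarrow> ((\<lambda>i. meas_dist M U (f i) g) \<longlongrightarrow> 0) F"
  let ?\<S> = "{{g \<in> L0 M. meas_dist M U g f < ennreal r} | U f r.
        U \<in> sets M \<and> emeasure M U < \<infinity> \<and> f \<in> L0 M \<and> 0 < r}"
  have "g \<in> W \<longrightarrow> (\<forall>\<^sub>F i in F. f i \<in> W)" if "generate_topology_on ?\<S> W" for W
    using that
  proof induction
    case (Basis W)
    then obtain U h r where W: "W = {k \<in> L0 M. meas_dist M U k h < ennreal r}"
      and U: "U \<in> sets M" "emeasure M U < \<infinity>" and h: "h \<in> L0 M" "0 < r" by auto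
    show ?case
    proof
      assume "g \<in> W"
      then have *: "meas_dist M U g h < ennreal r" by (simp add: W)
      have "((\<lambda>i. meas_dist M U (f i) g + meas_dist M U g h) \<longlongrightarrow> 0 + meas_dist M U g h) F"
        using R U by (intro tendsto_intros) auto
      then have "\<forall>\<^sub>F i in F. meas_dist M U (f i) g + meas_dist M U g h < ennreal r"
        using * by (intro order_tendstoD) auto
      then show "\<forall>\<^sub>F i in F. f i \<in> W"
        by eventually_elim
          (use meas_dist_triangle[OF U(1) assms(1) g h(1)] assms(1) in
            \<open>auto simp: W intro: le_less_trans\<close>)
    qed
  next
    case (UN K)
    show ?case
    proof
      assume "g \<in> \<Union>K"
      then obtain k where "k \<in> K" "g \<in> k" by blast
      with UN have "\<forall>\<^sub>F i in F. f i \<in> k" by blast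
      then show "\<forall>\<^sub>F i in F. f i \<in> \<Union>K"
        by eventually_elim (use \<open>k \<in> K\<close> in blast)
    qed
  qed (auto intro: eventually_conj)
  then show "limitin (tau M) f g F"
    using g unfolding limitin_def topspace_tau
    by (auto simp: tau_def openin_topology_generated_by_iff)
qed

end

theory Submission
  imports Defs
begin

text \<open>
  Closedness makes \<open>E\<close> lower semicontinuous for \<open>\<tau>(m)\<close>, and together with the Markov property this
  makes \<open>E\<close> decrease under truncations and \<open>\<bar>\<cdot>\<bar>\<close>. Consequently \<open>E\<close> has a minimiser among the functions
  \<open>0 \<le> g \<le> 1\<close> with \<open>g = 1\<close> on a level set \<open>A = {\<bar>f\<bar> \<ge> \<alpha>}\<close>, \<open>f \<in> D(E)\<close>; it is superharmonic. By full
  support these equilibrium potentials approximate \<open>1\<close>, so \<open>1\<close> is excessive and (ii) implies (i).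
  Conversely, if \<open>E\<close> is recurrent, constants may be added to test functions, so that a superharmonic
  function is orthogonal to its truncations and hence to itself; excessive functions follow by
  lower semicontinuity. If moreover \<open>E\<close> is irreducible, functions in the kernel are constant because
  their level sets are invariant. Finally, if all equilibrium potentials are constant, they are \<open>1\<close>,
  and comparing \<open>E(1)\<close> with the energy of nonconstant competitors forces \<open>E(1) = 0\<close>.
\<close>

text \<open>Without \<sigma>-finiteness \<tau>(m) need not be metrizable, so closedness has to speak
  of filters. They are confined to one argument, lower semicontinuity. Apart from the closure in the
  definition of excessive functions, the limits taken afterwards are limits of sequences converging
  at every point, and dominated convergence turns these into convergence in measure on sets of
  finite measure. The minimiser does not come from completeness alone: a minimising sequence is
  Cauchy for the energy, but E may vanish on nonzero functions, so nothing follows about \<tau>(m),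
  and the form topology asks for both. The bounds 0 \<le> g \<le> 1 and the lattice operations
  supply the missing limit.\<close>

section \<open>Neighbourhoods and closures for local convergence in measure\<close>

lemma meas_dist_mono: "U \<subseteq> V \<Longrightarrow> meas_dist M U f g \<le> meas_dist M V f g"
  unfolding meas_dist_def by (intro nn_integral_mono) (auto simp: indicator_def)

lemma emeasure_Un_finite:
  "U \<in> sets M \<Longrightarrow> V \<in> sets M \<Longrightarrow> emeasure M U < \<infinity> \<Longrightarrow> emeasure M V < \<infinity> \<Longrightarrow> emeasure M (U \<union> V) < \<infinity>"
  using emeasure_subadditive[of U M V]
  by (metis ennreal_add_less_top infinity_ennreal_def order_le_less_trans)

text \<open>One ball centred at \<open>g\<close> suffices: finite intersections are absorbed by the
  union of the sets and the minimum of the radii, and a ball around another centre is recentred by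
  the triangle inequality.\<close>

lemma openin_tau_nbhd:
  assumes "openin (tau M) W" "g \<in> W"
  shows "\<exists>U\<in>sets M. \<exists>\<delta>>0. emeasure M U < \<infinity> \<and> {k \<in> L0 M. meas_dist M U k g < ennreal \<delta>} \<subseteq> W"
proof -
  let ?\<S> = "{{g \<in> L0 M. meas_dist M U g f < ennreal r} | U f r.
        U \<in> sets M \<and> emeasure M U < \<infinity> \<and> f \<in> L0 M \<and> 0 < r}"
  have "generate_topology_on ?\<S> W"
    using assms(1) by (simp add: tau_def openin_topology_generated_by_iff)
  then show ?thesis
    using assms(2)
  proof induction
    case Empty
    then show ?case by simp
  next
    case (Int V W)
    then obtain U1 d1 U2 d2 where *: "U1 \<in> sets M" "U2 \<in> sets M" "0 < d1" "0 < d2"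
      "emeasure M U1 < \<infinity>" "emeasure M U2 < \<infinity>"
      "{k \<in> L0 M. meas_dist M U1 k g < ennreal d1} \<subseteq> V"
      "{k \<in> L0 M. meas_dist M U2 k g < ennreal d2} \<subseteq> W"
      by blast
    have le: "meas_dist M U1 k g \<le> meas_dist M (U1 \<union> U2) k g"
      "meas_dist M U2 k g \<le> meas_dist M (U1 \<union> U2) k g" for k
      by (auto intro: meas_dist_mono)
    have "emeasure M (U1 \<union> U2) < \<infinity>"
      using * by (intro emeasure_Un_finite)
    moreover have "{k \<in> L0 M. meas_dist M (U1 \<union> U2) k g < ennreal (min d1 d2)} \<subseteq> V \<inter> W"
      proof safe
      fix k assume k: "k \<in> L0 M" "meas_dist M (U1 \<union> U2) k g < ennreal (min d1 d2)"
      have "ennreal (min d1 d2) \<le> ennreal d1" "ennreal (min d1 d2) \<le> ennreal d2"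
        by (auto intro: ennreal_leI)
      with k le have "meas_dist M U1 k g < ennreal d1" "meas_dist M U2 k g < ennreal d2"
        by (meson order_le_less_trans order_less_le_trans)+
      with k * show "k \<in> V" "k \<in> W"
        by blast+
    qed
    ultimately show ?case
      using * by (intro bexI[of _ "U1 \<union> U2"] exI[of _ "min d1 d2"]) auto
  next
    case (UN K)
    then obtain k where "k \<in> K" "g \<in> k" by blast
    with UN.IH[of k] show ?case
      by (meson Union_upper order_trans)
  next
    case (Basis W)
    then obtain U f r where W: "W = {k \<in> L0 M. meas_dist M U k f < ennreal r}"
      and U: "U \<in> sets M" "emeasure M U < \<infinity>" and f: "f \<in> L0 M" "0 < r" by auto
    have g: "g \<in> L0 M" and lt: "meas_dist M U g f < ennreal r"
      using Basis.prems by (auto simp: W)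
    then obtain a where a: "meas_dist M U g f = ennreal a" "0 \<le> a" "a < r"
      by (cases "meas_dist M U g f") (auto simp: ennreal_less_iff)
    have "meas_dist M U k f < ennreal r"
      if "k \<in> L0 M" and k: "meas_dist M U k g < ennreal (r - a)" for k
    proof -
      have "meas_dist M U k f \<le> meas_dist M U k g + meas_dist M U g f"
        by (rule meas_dist_triangle) (use that U g f in auto)
      also have "\<dots> < ennreal (r - a) + ennreal a"
        unfolding a(1) using k
        by (simp add: ennreal_add_less_top ennreal_less_iff add.commute ennreal_add_left_cancel_less)
      also have "\<dots> = ennreal r"
        using a by (subst ennreal_plus[symmetric]) auto
      finally show ?thesis .
    qed
    then show ?case
      using U a by (intro bexI[of _ U] exI[of _ "r - a"]) (auto simp: W)
  qed
qed

lemma meas_dist_commute: "meas_dist M U f g = meas_dist M U g f"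
  by (simp add: meas_dist_def abs_minus_commute)

lemma in_closure_of_tau_iff:
  assumes "S \<subseteq> L0 M"
  shows "f \<in> tau M closure_of S \<longleftrightarrow> f \<in> L0 M \<and>
    (\<forall>U\<in>sets M. \<forall>\<delta>>0. emeasure M U < \<infinity> \<longrightarrow> (\<exists>g\<in>S. meas_dist M U g f < ennreal \<delta>))"
    (is "?L \<longleftrightarrow> ?R")
proof
  assume L: ?L
  then have f: "f \<in> L0 M"
    by (simp add: in_closure_of topspace_tau)
  have "\<exists>g\<in>S. meas_dist M U g f < ennreal \<delta>"
    if "U \<in> sets M" "0 < \<delta>" "emeasure M U < \<infinity>" for U \<delta>
  proof -
    let ?B = "{h \<in> L0 M. meas_dist M U h f < ennreal \<delta>}"
    have "openin (tau M) ?B"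
      unfolding tau_def using that f by (intro topology_generated_by_Basis) blast
    moreover have "f \<in> ?B"
      using f that by (simp add: meas_dist_self)
    ultimately obtain g where "g \<in> S" "g \<in> ?B"
      using L unfolding in_closure_of by (metis (no_types, lifting))
    then show ?thesis
      by auto
  qed
  with f show ?R by blast
next
  assume R: ?R
  show ?L
    unfolding in_closure_of topspace_tau
  proof (intro conjI allI impI)
    fix T assume "f \<in> T \<and> openin (tau M) T"
    then obtain U \<delta> where U: "U \<in> sets M" "0 < \<delta>" "emeasure M U < \<infinity>"
      and sub: "{k \<in> L0 M. meas_dist M U k f < ennreal \<delta>} \<subseteq> T"
      using openin_tau_nbhd[of M T f] by blast
    then obtain g where "g \<in> S" "meas_dist M U g f < ennreal \<delta>"
      using R by blast
    with sub assms show "\<exists>y. y \<in> S \<and> y \<in> T"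
      by (intro exI[of _ g]) auto
  qed (use R in blast)
qed

text \<open>Semi-finiteness makes limits unique up to null sets: a set of infinite measure on which
  \<open>f\<close> and \<open>g\<close> differ would contain a subset of positive finite measure,
  and \<open>meas_dist\<close> detects that one.\<close>

lemma AE_eq_if_meas_dist_eq_0:
  assumes sf: "semi_finite M" and f: "f \<in> L0 M" and g: "g \<in> L0 M"
    and dist: "\<And>U. U \<in> sets M \<Longrightarrow> emeasure M U < \<infinity> \<Longrightarrow> meas_dist M U f g = 0"
  shows "AE x in M. f x = g x"
proof -
  have [measurable]: "f \<in> borel_measurable M" "g \<in> borel_measurable M"
    using f g by (auto simp: L0_def)
  define N where "N = {x \<in> space M. f x \<noteq> g x}"
  have N: "N \<in> sets M"
    unfolding N_def by measurable
  have null: "emeasure M B = 0" if "B \<in> sets M" "B \<subseteq> N" "emeasure M B < \<infinity>" for B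
  proof -
    have [measurable]: "B \<in> sets M" by fact
    have "AE x in M. ennreal (min \<bar>f x - g x\<bar> 1) * indicator B x = 0"
      using dist[OF that(1,3)] unfolding meas_dist_def
      by (subst (asm) nn_integral_0_iff_AE) auto
    then have "AE x in M. x \<notin> B"
    proof eventually_elim
      case (elim x)
      have "0 < min \<bar>f x - g x\<bar> 1" if "x \<in> B"
        using that \<open>B \<subseteq> N\<close> by (auto simp: N_def)
      with elim show ?case
        by (auto simp: ennreal_eq_0_iff simp flip: not_less)
    qed
    then show ?thesis
      using AE_iff_null_sets[OF that(1)] by auto
  qed
  have "emeasure M N = 0"
  proof (cases "emeasure M N = \<infinity>")
    case True
    then obtain B where "B \<in> sets M" "B \<subseteq> N" "0 < emeasure M B" "emeasure M B < \<infinity>"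
      using sf N unfolding semi_finite_def by blast
    with null[of B] show ?thesis by auto
  next
    case False
    with null[OF N] show ?thesis by (simp add: top.not_eq_extremum)
  qed
  then show ?thesis
    using AE_iff_measurable[OF N N_def[symmetric]] by simp
qed

lemma meas_dist_tendsto_0:
  assumes "U \<in> sets M" "emeasure M U < \<infinity>" "\<And>n. f n \<in> L0 M" "g \<in> L0 M"
    and lim: "\<And>x. x \<in> space M \<Longrightarrow> (\<lambda>n. f n x) \<longlonglongrightarrow> g x"
  shows "(\<lambda>n. meas_dist M U (f n) g) \<longlonglongrightarrow> 0"
proof -
  have [measurable]: "U \<in> sets M" "\<And>n. f n \<in> borel_measurable M" "g \<in> borel_measurable M"
    using assms by (auto simp: L0_def)
  have "(\<lambda>n. \<integral>\<^sup>+x. ennreal (min \<bar>f n x - g x\<bar> 1) * indicator U x \<partial>M) \<longlonglongrightarrow> (\<integral>\<^sup>+x. 0 \<partial>M)"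
  proof (rule nn_integral_dominated_convergence[where w = "indicator U"])
    show "(\<integral>\<^sup>+x. indicator U x \<partial>M) < \<infinity>"
      using assms by simp
    show "AE x in M. ennreal (min \<bar>f n x - g x\<bar> 1) * indicator U x \<le> indicator U x" for n
      by (auto simp: indicator_def)
    show "AE x in M. (\<lambda>n. ennreal (min \<bar>f n x - g x\<bar> 1) * indicator U x) \<longlonglongrightarrow> 0"
    proof (rule AE_I2)
      fix x assume "x \<in> space M"
      then have "(\<lambda>n. ennreal (min \<bar>f n x - g x\<bar> 1)) \<longlonglongrightarrow> ennreal (min \<bar>g x - g x\<bar> 1)"
        by (intro tendsto_ennrealI tendsto_intros lim)
      then show "(\<lambda>n. ennreal (min \<bar>f n x - g x\<bar> 1) * indicator U x) \<longlonglongrightarrow> 0"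
        by (cases "x \<in> U") auto
    qed
  qed auto
  then show ?thesis
    by (simp add: meas_dist_def)
qed

section \<open>Quadratic forms\<close>

locale L0_quadratic_form =
  fixes M :: "'a measure" and E :: "('a \<Rightarrow> real) \<Rightarrow> ennreal"
  assumes quadratic: "quadratic_form M E"
begin

abbreviation D :: "('a \<Rightarrow> real) set" where
  "D \<equiv> form_domain M E"

text \<open>Infinite energy is sent to 0, so estimates in terms of \<open>e\<close> carry
  information only together with membership in \<open>D\<close>.\<close>

abbreviation e :: "('a \<Rightarrow> real) \<Rightarrow> real" where
  "e u \<equiv> enn2real (E u)"

lemma E_cong_AE: "f \<in> L0 M \<Longrightarrow> g \<in> L0 M \<Longrightarrow> (AE x in M. f x = g x) \<Longrightarrow> E f = E g"
  using quadratic unfolding quadratic_form_def by blast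

lemma parallelogram:
  assumes "u \<in> L0 M" "v \<in> L0 M"
  shows "E (\<lambda>x. u x + v x) + E (\<lambda>x. u x - v x) = 2 * E u + 2 * E v"
  using quadratic[unfolded quadratic_form_def, THEN conjunct2, THEN conjunct1, rule_format, OF assms]
  by (rule sym)

lemma E_scale: "u \<in> L0 M \<Longrightarrow> E (\<lambda>x. c * u x) = ennreal (c\<^sup>2) * E u"
  using quadratic[unfolded quadratic_form_def, THEN conjunct2, THEN conjunct2, rule_format, of u c]
  by (simp only: power2_abs)

lemma E_minus: "u \<in> L0 M \<Longrightarrow> E (\<lambda>x. - u x) = E u"
  using E_scale[of u "-1"] by simp

lemma D_L0: "u \<in> D \<Longrightarrow> u \<in> L0 M"
  by (simp add: form_domain_def)

lemma E_eq: "u \<in> D \<Longrightarrow> E u = ennreal (e u)"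
  by (simp add: form_domain_def)

lemma E_le_iff: "u \<in> D \<Longrightarrow> v \<in> D \<Longrightarrow> E u \<le> E v \<longleftrightarrow> e u \<le> e v"
  using E_eq[of u] E_eq[of v] by (metis enn2real_nonneg ennreal_le_iff)

lemma D_I: "u \<in> L0 M \<Longrightarrow> E u \<le> ennreal C \<Longrightarrow> u \<in> D"
  unfolding form_domain_def using le_less_trans[OF _ ennreal_less_top] by auto

lemma L0_add: "u \<in> L0 M \<Longrightarrow> v \<in> L0 M \<Longrightarrow> (\<lambda>x. u x + v x) \<in> L0 M"
  and L0_diff: "u \<in> L0 M \<Longrightarrow> v \<in> L0 M \<Longrightarrow> (\<lambda>x. u x - v x) \<in> L0 M"
  and L0_scale: "u \<in> L0 M \<Longrightarrow> (\<lambda>x. c * u x) \<in> L0 M"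
  and L0_const: "(\<lambda>x. c) \<in> L0 M"
  by (auto simp: L0_def)

lemma L0_clamp: "u \<in> L0 M \<Longrightarrow> (\<lambda>x. max 0 (min c (u x))) \<in> L0 M"
  and L0_pos_part: "u \<in> L0 M \<Longrightarrow> (\<lambda>x. max 0 (u x)) \<in> L0 M"
  by (auto simp: L0_def)

lemma D_scale: "u \<in> D \<Longrightarrow> (\<lambda>x. c * u x) \<in> D"
  by (auto simp: form_domain_def E_scale L0_scale ennreal_mult_less_top)

lemma D_add: "u \<in> D \<Longrightarrow> v \<in> D \<Longrightarrow> (\<lambda>x. u x + v x) \<in> D"
  and D_diff: "u \<in> D \<Longrightarrow> v \<in> D \<Longrightarrow> (\<lambda>x. u x - v x) \<in> D"
proof -
  assume u: "u \<in> D" and v: "v \<in> D"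
  have "E (\<lambda>x. u x + v x) + E (\<lambda>x. u x - v x) < \<infinity>"
    using u v by (subst parallelogram) (auto simp: form_domain_def ennreal_mult_less_top)
  then show "(\<lambda>x. u x + v x) \<in> D" "(\<lambda>x. u x - v x) \<in> D"
    using u v by (auto simp: form_domain_def L0_add L0_diff)
qed

lemma e_scale: "u \<in> D \<Longrightarrow> e (\<lambda>x. c * u x) = c\<^sup>2 * e u"
  by (simp add: D_L0 E_scale enn2real_mult)

lemma e_minus: "u \<in> D \<Longrightarrow> e (\<lambda>x. - u x) = e u"
  by (simp add: D_L0 E_minus)

lemma e_parallelogram:
  assumes "u \<in> D" "v \<in> D"
  shows "e (\<lambda>x. u x + v x) + e (\<lambda>x. u x - v x) = 2 * e u + 2 * e v"
proof -
  have "E w < top" if "w \<in> D" for w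
    using that by (simp add: form_domain_def)
  with assms show ?thesis
    using arg_cong[OF parallelogram[of u v], of enn2real]
    by (simp add: D_L0 D_add D_diff enn2real_plus enn2real_mult ennreal_mult_less_top)
qed

text \<open>The Jordan-von Neumann computation behind the additivity of \<open>bilin\<close>: add
  the identities 1 and 3, subtract 2, and remove \<open>e (\<lambda>x. v x - w x)\<close> by
  4.\<close>

lemma e_add3:
  assumes "u \<in> D" "v \<in> D" "w \<in> D"
  shows "e (\<lambda>x. u x + v x + w x)
    = e (\<lambda>x. u x + v x) + e (\<lambda>x. u x + w x) + e (\<lambda>x. v x + w x) - e u - e v - e w"
proof -
  have 1: "e (\<lambda>x. u x + v x + w x) + e (\<lambda>x. u x + v x - w x) = 2 * e (\<lambda>x. u x + v x) + 2 * e w"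
    by (rule e_parallelogram) (use assms D_add in auto)
  have "(\<lambda>x. u x + (v x - w x)) = (\<lambda>x. u x + v x - w x)"
    "(\<lambda>x. u x - (v x - w x)) = (\<lambda>x. u x - v x + w x)"
    "(\<lambda>x. u x + w x + v x) = (\<lambda>x. u x + v x + w x)"
    "(\<lambda>x. u x + w x - v x) = (\<lambda>x. u x - v x + w x)"
    by (simp_all add: fun_eq_iff)
  then have 2: "e (\<lambda>x. u x + v x - w x) + e (\<lambda>x. u x - v x + w x) = 2 * e u + 2 * e (\<lambda>x. v x - w x)"
    and 3: "e (\<lambda>x. u x + v x + w x) + e (\<lambda>x. u x - v x + w x) = 2 * e (\<lambda>x. u x + w x) + 2 * e v"
    using e_parallelogram[OF assms(1) D_diff[OF assms(2,3)]]
      e_parallelogram[OF D_add[OF assms(1,3)] assms(2)] by simp_all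
  have 4: "e (\<lambda>x. v x + w x) + e (\<lambda>x. v x - w x) = 2 * e v + 2 * e w"
    by (rule e_parallelogram) (use assms in auto)
  show ?thesis
    using 1 2 3 4 by argo
qed

lemma e_add: "u \<in> D \<Longrightarrow> v \<in> D \<Longrightarrow> e (\<lambda>x. u x + v x) = e u + e v + 2 * bilin E u v"
  unfolding bilin_def by (drule (1) e_parallelogram) argo

lemma bilin_add:
  assumes "u \<in> D" "v \<in> D" "w \<in> D"
  shows "bilin E u (\<lambda>x. v x + w x) = bilin E u v + bilin E u w"
proof -
  have "e (\<lambda>x. u x + (v x + w x)) = e u + e (\<lambda>x. v x + w x) + 2 * bilin E u (\<lambda>x. v x + w x)"
    by (rule e_add) (use assms D_add in auto)
  then show ?thesis
    using e_add3[OF assms] e_add[of u v] e_add[of u w] assms by (simp add: add.assoc)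
qed

lemma bilin_minus: "u \<in> D \<Longrightarrow> v \<in> D \<Longrightarrow> bilin E u (\<lambda>x. - v x) = - bilin E u v"
  by (simp add: bilin_def diff_divide_distrib)

lemma bilin_diff:
  assumes "u \<in> D" "v \<in> D" "w \<in> D"
  shows "bilin E u (\<lambda>x. v x - w x) = bilin E u v - bilin E u w"
  using bilin_add[of u v "\<lambda>x. - w x"] assms D_scale[of w "-1"] by (simp add: bilin_minus)

lemma bilin_self: "u \<in> D \<Longrightarrow> bilin E u u = e u"
  using e_add[of u u] e_scale[of u 2] by simp

text \<open>Later variations run along the scales \<open>n\<close> and \<open>1 / n\<close> with
  \<open>n\<close> a natural number, where homogeneity follows from additivity by induction.\<close>

lemma bilin_of_nat:
  assumes "u \<in> D" "v \<in> D"
  shows "bilin E u (\<lambda>x. real n * v x) = real n * bilin E u v"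
proof (induction n)
  case 0
  then show ?case by (simp add: bilin_def)
next
  case (Suc n)
  have "bilin E u (\<lambda>x. v x + real n * v x) = bilin E u v + real n * bilin E u v"
    using bilin_add[OF assms D_scale[OF assms(2)]] Suc by simp
  then show ?case
    by (simp add: distrib_right)
qed

lemma bilin_divide_nat:
  assumes "u \<in> D" "v \<in> D"
  shows "bilin E u (\<lambda>x. v x / real n) = bilin E u v / real n"
proof (cases "n = 0")
  case True
  then show ?thesis by (simp add: bilin_def)
next
  case False
  have "(\<lambda>x. v x / real n) \<in> D"
    using D_scale[OF assms(2), of "1 / real n"] by simp
  then have "bilin E u v = real n * bilin E u (\<lambda>x. v x / real n)"
    using bilin_of_nat[OF assms(1), of "\<lambda>x. v x / real n" n] False by simp
  then show ?thesis
    using False by simp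
qed

text \<open>Young's inequality in the role of a triangle inequality, obtained from
  \<open>e (u - n v) \<ge> 0\<close>. A large \<open>n\<close> brings the factor of
  \<open>e u\<close> close to 1.\<close>

lemma e_add_le:
  assumes "u \<in> D" "v \<in> D" "0 < n"
  shows "e (\<lambda>x. u x + v x) \<le> (1 + 1 / real n) * e u + (1 + real n) * e v"
proof -
  have "0 \<le> e (\<lambda>x. u x + - (real n * v x))"
    by simp
  also have "\<dots> = e u + e (\<lambda>x. - (real n * v x)) + 2 * bilin E u (\<lambda>x. - (real n * v x))"
    using D_scale[OF assms(2), of "- real n"] assms(1) by (intro e_add) auto
  also have "\<dots> = e u + (real n)\<^sup>2 * e v - 2 * (real n * bilin E u v)"
    using assms by (simp add: bilin_minus bilin_of_nat D_scale e_minus e_scale)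
  finally have "2 * bilin E u v \<le> e u / real n + real n * e v"
    using assms(3) by (simp add: field_simps power2_eq_square)
  moreover have "(1 + 1 / real n) * e u + (1 + real n) * e v = e u + e u / real n + e v + real n * e v"
    by (simp add: distrib_right)
  ultimately show ?thesis
    using e_add[OF assms(1,2)] by linarith
qed

lemma e_continuous:
  assumes u: "u \<in> D" and \<epsilon>: "0 < \<epsilon>"
  shows "\<exists>\<delta>>0. \<forall>v\<in>D. e v < \<delta> \<longrightarrow> e (\<lambda>x. u x + v x) < e u + \<epsilon>"
proof -
  obtain n where n: "2 * e u / \<epsilon> < real n"
    using reals_Archimedean2 by blast
  have "0 \<le> 2 * e u / \<epsilon>"
    using \<epsilon> by simp
  with n have pos: "0 < n"
    by linarith
  have "e (\<lambda>x. u x + v x) < e u + \<epsilon>" if v: "v \<in> D" "e v < \<epsilon> / (2 * (1 + real n))" for v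
  proof -
    have "e (\<lambda>x. u x + v x) \<le> e u + e u / real n + (1 + real n) * e v"
      using e_add_le[OF u v(1) pos] by (simp add: algebra_simps)
    moreover have "e u / real n < \<epsilon> / 2"
      using n pos \<epsilon> by (simp add: field_simps)
    moreover have "(1 + real n) * e v < \<epsilon> / 2"
      using v(2) by (simp add: field_simps)
    ultimately show ?thesis by linarith
  qed
  moreover have "0 < \<epsilon> / (2 * (1 + real n))"
    using \<epsilon> by simp
  ultimately show ?thesis
    by blast
qed

text \<open>First variation: along \<open>v / n\<close> the quadratic term is of order
  \<open>1 / n\<^sup>2\<close>, so a negative linear term of order \<open>1 / n\<close> would win
  for large \<open>n\<close>.\<close>

lemma bilin_nonneg_if_minimal:
  assumes u: "u \<in> D" and v: "v \<in> D"
    and le: "\<And>n::nat. 0 < n \<Longrightarrow> E u \<le> E (\<lambda>x. u x + v x / real n)"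
  shows "0 \<le> bilin E u v"
proof (rule ccontr)
  assume neg: "\<not> 0 \<le> bilin E u v"
  obtain n where n: "e v / (- 2 * bilin E u v) < real n"
    using reals_Archimedean2 by blast
  have "0 \<le> e v / (- 2 * bilin E u v)"
    using neg by (intro divide_nonneg_pos) auto
  with n have pos: "0 < n"
    by linarith
  have vn: "(\<lambda>x. v x / real n) \<in> D"
    using D_scale[OF v, of "1 / real n"] by simp
  have "e u \<le> e (\<lambda>x. u x + v x / real n)"
    using le[OF pos] D_add[OF u vn] u by (simp add: E_le_iff)
  also have "\<dots> = e u + e v / (real n)\<^sup>2 + 2 * bilin E u v / real n"
    using e_add[OF u vn] e_scale[OF v, of "1 / real n"] u v
    by (simp add: bilin_divide_nat power_divide)
  finally have "0 \<le> e v + 2 * bilin E u v * real n"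
    using pos by (simp add: field_simps power2_eq_square)
  with n neg show False
    by (simp add: field_simps)
qed

text \<open>The energy of \<open>u + n k\<close> is affine in \<open>n\<close> and nonnegative, so
  its slope \<open>2 * bilin E u k\<close> is nonnegative. The same holds for \<open>- k\<close>,
  hence the slope vanishes.\<close>

lemma E_add_kernel:
  assumes u: "u \<in> D" and k: "k \<in> form_kernel M E"
  shows "E (\<lambda>x. u x + k x) = E u"
proof -
  have kD: "k \<in> D" and [simp]: "e k = 0"
    using k by (auto simp: form_kernel_def form_domain_def)
  have ge: "0 \<le> bilin E u k" if "u \<in> D" "k \<in> D" "e k = 0" for u k
  proof (rule ccontr)
    assume neg: "\<not> 0 \<le> bilin E u k"
    then obtain n where n: "e u / (- 2 * bilin E u k) < real n"
      using reals_Archimedean2 by blast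
    have "0 \<le> e (\<lambda>x. u x + real n * k x)" by simp
    also have "\<dots> = e u + 2 * (real n * bilin E u k)"
      using that by (simp add: e_add D_scale e_scale bilin_of_nat)
    finally show False
      using n neg by (simp add: field_simps)
  qed
  have "0 \<le> bilin E u (\<lambda>x. - k x)"
    by (rule ge) (use u kD D_scale[of k "-1"] in \<open>auto simp: e_minus\<close>)
  with ge[of u k] u kD have "bilin E u k = 0"
    by (simp add: bilin_minus)
  then show ?thesis
    using u kD e_add[of u k] by (intro antisym) (simp_all add: E_le_iff D_add)
qed

lemma L0_minI: "f \<in> L0 M \<Longrightarrow> g \<in> L0 M \<Longrightarrow> (\<lambda>x. min (f x) (g x)) \<in> L0 M"
  and L0_maxI: "f \<in> L0 M \<Longrightarrow> g \<in> L0 M \<Longrightarrow> (\<lambda>x. max (f x) (g x)) \<in> L0 M"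
  and L0_absI: "f \<in> L0 M \<Longrightarrow> (\<lambda>x. \<bar>f x\<bar>) \<in> L0 M"
  by (auto simp: L0_def)

section \<open>Neighbourhoods in the form topology\<close>

lemma topspace_form_topology: "topspace (form_topology M E) = D"
proof -
  have "topspace (subtopology (tau M) D) = D"
    by (auto simp: topspace_tau D_L0)
  then have "openin (subtopology (tau M) D) D"
    by (metis openin_topspace)
  moreover have "W \<subseteq> D" if "openin (seminorm_topology M E) W" for W
    using openin_subset[OF that] by (auto simp: seminorm_topology_def)
  moreover have "W \<subseteq> D" if "openin (subtopology (tau M) D) W" for W
    using openin_subset[OF that] by (simp add: topspace_tau)
  ultimately show ?thesis
    unfolding form_topology_def topology_generated_by_topspace by blast
qed

lemma openin_seminorm_nbhd:
  assumes "openin (seminorm_topology M E) W" "k \<in> W"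
  shows "\<exists>\<delta>>0. {h \<in> D. e (\<lambda>x. h x - k x) < \<delta>} \<subseteq> W"
proof -
  have "generate_topology_on
     {{g \<in> D. sqrt (e (\<lambda>x. g x - f x)) < r} | f r. f \<in> D \<and> 0 < r} W"
    using assms(1) by (simp add: seminorm_topology_def openin_topology_generated_by_iff)
  then show ?thesis
    using assms(2)
  proof induction
    case Empty
    then show ?case by simp
  next
    case (Int V W)
    then have "k \<in> V" "k \<in> W" by auto
    from Int.IH(1)[OF this(1)] Int.IH(2)[OF this(2)]
    obtain d1 d2 where "0 < d1" "0 < d2" "{h \<in> D. e (\<lambda>x. h x - k x) < d1} \<subseteq> V"
      "{h \<in> D. e (\<lambda>x. h x - k x) < d2} \<subseteq> W"
      by blast
    then show ?case
      by (intro exI[of _ "min d1 d2"]) auto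
  next
    case (UN K)
    then obtain V where "V \<in> K" "k \<in> V" by blast
    with UN.IH[of V] show ?case
      by (meson Union_upper order_trans)
  next
    case (Basis W)
    then obtain f r where W: "W = {g \<in> D. sqrt (e (\<lambda>x. g x - f x)) < r}"
      and f: "f \<in> D" "0 < r" by auto
    have k: "k \<in> D" and "sqrt (e (\<lambda>x. k x - f x)) < r"
      using Basis.prems by (auto simp: W)
    then have "e (\<lambda>x. k x - f x) < r\<^sup>2"
      using f by (metis abs_of_pos real_less_rsqrt real_sqrt_abs real_sqrt_less_iff)
    then obtain d where d: "0 < d"
      "\<And>v. v \<in> D \<Longrightarrow> e v < d \<Longrightarrow> e (\<lambda>x. (k x - f x) + v x) < r\<^sup>2"
      using e_continuous[OF D_diff[OF k f(1)], of "r\<^sup>2 - e (\<lambda>x. k x - f x)"] by auto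
    have "h \<in> W" if "h \<in> D" "e (\<lambda>x. h x - k x) < d" for h
    proof -
      have "e (\<lambda>x. h x - f x) < r\<^sup>2"
        using d(2)[OF D_diff[OF that(1) k] that(2)] by simp
      then show ?thesis
        using that f by (simp add: W real_less_lsqrt)
    qed
    with d(1) show ?case
      by blast
  qed
qed

lemma openin_form_nbhd:
  assumes "openin (form_topology M E) W" "k \<in> W"
  shows "\<exists>U\<in>sets M. \<exists>\<delta>>0. emeasure M U < \<infinity> \<and>
    {h \<in> D. meas_dist M U h k < ennreal \<delta> \<and> e (\<lambda>x. h x - k x) < \<delta>} \<subseteq> W"
proof -
  have "generate_topology_on
     ({W. openin (subtopology (tau M) D) W} \<union> {W. openin (seminorm_topology M E) W}) W"
    using assms(1) by (simp add: form_topology_def openin_topology_generated_by_iff)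
  then show ?thesis
    using assms(2)
  proof induction
    case Empty
    then show ?case by simp
  next
    case (Int V W)
    then have "k \<in> V" "k \<in> W" by auto
    from Int.IH(1)[OF this(1)] Int.IH(2)[OF this(2)]
    obtain U1 d1 U2 d2 where *: "U1 \<in> sets M" "U2 \<in> sets M" "0 < d1" "0 < d2"
      "emeasure M U1 < \<infinity>" "emeasure M U2 < \<infinity>"
      and sub: "{h \<in> D. meas_dist M U1 h k < ennreal d1 \<and> e (\<lambda>x. h x - k x) < d1} \<subseteq> V"
      "{h \<in> D. meas_dist M U2 h k < ennreal d2 \<and> e (\<lambda>x. h x - k x) < d2} \<subseteq> W"
      by blast
    have "{h \<in> D. meas_dist M (U1 \<union> U2) h k < ennreal (min d1 d2) \<and>
        e (\<lambda>x. h x - k x) < min d1 d2} \<subseteq> V \<inter> W"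
    proof (intro subsetI IntI)
      fix h assume h: "h \<in> {h \<in> D. meas_dist M (U1 \<union> U2) h k < ennreal (min d1 d2) \<and>
        e (\<lambda>x. h x - k x) < min d1 d2}"
      have "ennreal (min d1 d2) \<le> ennreal d1" "ennreal (min d1 d2) \<le> ennreal d2"
        by (auto intro: ennreal_leI)
      with h have "meas_dist M U1 h k < ennreal d1" "meas_dist M U2 h k < ennreal d2"
        using meas_dist_mono[of U1 "U1 \<union> U2" M h k] meas_dist_mono[of U2 "U1 \<union> U2" M h k] by auto
      then have "h \<in> {h \<in> D. meas_dist M U1 h k < ennreal d1 \<and> e (\<lambda>x. h x - k x) < d1}"
        "h \<in> {h \<in> D. meas_dist M U2 h k < ennreal d2 \<and> e (\<lambda>x. h x - k x) < d2}"
        using h by simp_all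
      then show "h \<in> V" "h \<in> W"
        using sub by blast+
    qed
    with * show ?case
      by (intro bexI[of _ "U1 \<union> U2"] exI[of _ "min d1 d2"]) (use emeasure_Un_finite[of U1 M U2] in auto)
  next
    case (UN K)
    then obtain V where "V \<in> K" "k \<in> V" by blast
    with UN.IH[of V] show ?case
      by (meson Union_upper order_trans)
  next
    case (Basis W)
    then consider T where "openin (tau M) T" "W = T \<inter> D" | "openin (seminorm_topology M E) W"
      by (auto simp: openin_subtopology)
    then show ?case
    proof cases
      case 1
      then obtain U d where U: "U \<in> sets M" "0 < d" "emeasure M U < \<infinity>"
        "{h \<in> L0 M. meas_dist M U h k < ennreal d} \<subseteq> T"
        using openin_tau_nbhd[of M T k] Basis.prems by auto
      have "{h \<in> D. meas_dist M U h k < ennreal d \<and> e (\<lambda>x. h x - k x) < d} \<subseteq> W"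
        using U(4) 1(2) by (auto dest: D_L0)
      with U show ?thesis by blast
    next
      case 2
      then obtain d where d: "0 < d" "{h \<in> D. e (\<lambda>x. h x - k x) < d} \<subseteq> W"
        using openin_seminorm_nbhd[OF _ Basis.prems] by blast
      then show ?thesis
        by (intro bexI[of _ "{}"] exI[of _ d]) auto
    qed
  qed
qed

lemma openin_form_ball_tau:
  assumes "U \<in> sets M" "emeasure M U < \<infinity>" "0 < \<delta>" "k \<in> L0 M"
  shows "openin (form_topology M E) {h \<in> D. meas_dist M U h k < ennreal \<delta>}"
proof -
  have "openin (tau M) {h \<in> L0 M. meas_dist M U h k < ennreal \<delta>}"
    unfolding tau_def using assms by (intro topology_generated_by_Basis) blast
  moreover have "{h \<in> D. meas_dist M U h k < ennreal \<delta>} = {h \<in> L0 M. meas_dist M U h k < ennreal \<delta>} \<inter> D"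
    by (auto dest: D_L0)
  ultimately have "openin (subtopology (tau M) D) {h \<in> D. meas_dist M U h k < ennreal \<delta>}"
    by (auto simp: openin_subtopology)
  then show ?thesis
    unfolding form_topology_def by (intro topology_generated_by_Basis) simp
qed

lemma openin_form_ball_seminorm:
  assumes "0 < \<delta>" "k \<in> D"
  shows "openin (form_topology M E) {h \<in> D. e (\<lambda>x. h x - k x) < \<delta>}"
proof -
  have "openin (seminorm_topology M E) {h \<in> D. sqrt (e (\<lambda>x. h x - k x)) < sqrt \<delta>}"
    unfolding seminorm_topology_def using assms
    by (intro topology_generated_by_Basis CollectI exI[of _ k] exI[of _ "sqrt \<delta>"]) auto
  then have "openin (seminorm_topology M E) {h \<in> D. e (\<lambda>x. h x - k x) < \<delta>}"
    by simp
  then show ?thesis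
    unfolding form_topology_def by (intro topology_generated_by_Basis) simp
qed

end

section \<open>Lower semicontinuity\<close>

locale closed_L0_form = L0_quadratic_form +
  assumes semi_finite: "semi_finite M" and closed: "closed_form M E"
begin

text \<open>
  The energies of functions near \<open>f\<close> have a limit inferior \<open>m\<close>. By the parallelogram identity,
  the sets of functions near \<open>f\<close> with energy close to \<open>m\<close> form a Cauchy filter base; its limit in the
  form topology can only be \<open>f\<close>.
\<close>

lemma lower_semicontinuous:
  assumes f: "f \<in> L0 M"
    and approx: "\<And>U \<delta>. U \<in> sets M \<Longrightarrow> emeasure M U < \<infinity> \<Longrightarrow> 0 < \<delta> \<Longrightarrow>
      \<exists>g\<in>L0 M. meas_dist M U g f < ennreal \<delta> \<and> E g \<le> ennreal C"
  shows "E f \<le> ennreal C"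
proof -
  \<comment> \<open>The pairs index neighbourhoods of \<open>f\<close> and are directed by unions of
    the sets and minima of the radii. In \<open>S\<close> the radius also bounds the excess of the
    energy over \<open>m\<close>.\<close>
  define P where "P = {(U, \<delta>). U \<in> sets M \<and> emeasure M U < \<infinity> \<and> 0 < (\<delta>::real)}"
  define N where "N = (\<lambda>(U, \<delta>). {g \<in> L0 M. meas_dist M U g f < ennreal \<delta>})"
  define i where "i p = (INF g\<in>N p. E g)" for p
  define m where "m = (SUP p\<in>P. i p)"
  define S where "S = (\<lambda>(U, \<delta>). {g \<in> N (U, \<delta>). E g < m + ennreal \<delta>})"
  define F where "F = (INF p\<in>P. principal (S p))"
  have i_le_m: "i p \<le> m" if "p \<in> P" for p
    unfolding m_def using that by (rule SUP_upper)
  have m_le: "m \<le> ennreal C"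
    unfolding m_def
  proof (rule SUP_least)
    fix p assume "p \<in> P"
    then obtain g where "g \<in> N p" "E g \<le> ennreal C"
      using approx by (fastforce simp: P_def N_def)
    then show "i p \<le> ennreal C"
      unfolding i_def by (blast intro: INF_lower2)
  qed
  then obtain mr where mr: "m = ennreal mr" "0 \<le> mr"
    by (cases m) (auto simp: top_unique)
  have E_less: "e g < mr + \<delta>" if "g \<in> D" "0 < \<delta>" "E g < m + ennreal \<delta>" for g \<delta>
  proof -
    have "ennreal (e g) < ennreal (mr + \<delta>)"
      using that(2,3) mr by (subst E_eq[OF that(1), symmetric]) (simp add: ennreal_plus)
    then show ?thesis
      by (simp add: ennreal_less_iff)
  qed
  have S_nonempty: "S p \<noteq> {}" if p: "p \<in> P" for p
  proof -
    obtain U \<delta> where p_eq: "p = (U, \<delta>)" and "0 < \<delta>"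
      using p by (auto simp: P_def)
    then have "m < m + ennreal \<delta>"
      using mr by (simp add: ennreal_less_iff flip: ennreal_plus)
    then have "i p < m + ennreal \<delta>"
      using i_le_m[OF p] by order
    then show ?thesis
      by (auto simp: i_def S_def p_eq INF_less_iff)
  qed
  have N_mono: "N (U, \<delta>) \<subseteq> N (V, \<epsilon>)" if "V \<subseteq> U" "\<delta> \<le> \<epsilon>" for U V \<delta> \<epsilon>
  proof -
    have "meas_dist M V g f < ennreal \<epsilon>" if "meas_dist M U g f < ennreal \<delta>" for g
      using that meas_dist_mono[OF \<open>V \<subseteq> U\<close>, of M g f] ennreal_leI[OF \<open>\<delta> \<le> \<epsilon>\<close>] by order
    then show ?thesis
      by (auto simp: N_def)
  qed
  have S_mono: "S (U, \<delta>) \<subseteq> S (V, \<epsilon>)" if "V \<subseteq> U" "\<delta> \<le> \<epsilon>" for U V \<delta> \<epsilon>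
  proof -
    have "m + ennreal \<delta> \<le> m + ennreal \<epsilon>"
      using that by (intro add_left_mono ennreal_leI)
    then show ?thesis
      using N_mono[OF that] by (auto simp: S_def intro: order_less_le_trans)
  qed
  have P_Un: "(U \<union> V, min \<delta> \<epsilon>) \<in> P" if "(U, \<delta>) \<in> P" "(V, \<epsilon>) \<in> P" for U V \<delta> \<epsilon>
    using that emeasure_Un_finite[of U M V] by (auto simp: P_def)
  have P_0: "({}, 1) \<in> P"
    by (simp add: P_def)
  have ev: "eventually Q F \<longleftrightarrow> (\<exists>p\<in>P. \<forall>g\<in>S p. Q g)" for Q
    unfolding F_def
  proof (subst eventually_INF_base)
    show "P \<noteq> {}"
      using P_0 by blast
    fix p q assume pq: "p \<in> P" "q \<in> P"
    obtain U \<delta> V \<epsilon> where eqs: "p = (U, \<delta>)" "q = (V, \<epsilon>)"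
      by (cases p, cases q)
    have "S (U \<union> V, min \<delta> \<epsilon>) \<subseteq> S p" "S (U \<union> V, min \<delta> \<epsilon>) \<subseteq> S q"
      unfolding eqs by (rule S_mono; simp)+
    then show "\<exists>x\<in>P. principal (S x) \<le> inf (principal (S p)) (principal (S q))"
      using P_Un pq unfolding eqs by (intro bexI[of _ "(U \<union> V, min \<delta> \<epsilon>)"]) auto
  qed (simp add: eventually_principal)
  have S_D: "g \<in> D" if "g \<in> S p" for g p
    using that mr(1) by (cases p) (auto simp: S_def N_def form_domain_def elim!: order_less_trans)
  have "F \<noteq> bot"
    using S_nonempty by (auto simp: trivial_limit_def ev)
  moreover have "F \<le> principal (topspace (form_topology M E))"
    unfolding topspace_form_topology le_principal ev
    using S_D P_0 by blast
  moreover have "cauchy_filter_in (form_topology M E) F"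
    unfolding cauchy_filter_in_def
  proof (intro allI impI, elim conjE)
    fix W assume "openin (form_topology M E) W" "(\<lambda>x. 0) \<in> W"
    from openin_form_nbhd[OF this] obtain U \<eta> where U: "U \<in> sets M" "emeasure M U < \<infinity>" "0 < \<eta>"
      and W: "\<And>h. h \<in> D \<Longrightarrow> meas_dist M U h (\<lambda>x. 0) < ennreal \<eta> \<Longrightarrow> e h < \<eta> \<Longrightarrow> h \<in> W"
      by auto
    \<comment> \<open>A neighbourhood on which the infimum of the energies is above
      \<open>m - \<eta> / 16\<close>. To keep the subtraction in the nonnegative reals, the case
      \<open>m < \<eta> / 16\<close> is split off; there any neighbourhood works.\<close>
    obtain V \<epsilon> where V: "(V, \<epsilon>) \<in> P" and i_V: "m < i (V, \<epsilon>) + ennreal (\<eta> / 16)"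
    proof (cases "mr < \<eta> / 16")
      case True
      then have "m < ennreal (\<eta> / 16)"
        using mr U(3) by (simp add: ennreal_less_iff)
      also have "\<dots> \<le> i ({}, 1) + ennreal (\<eta> / 16)"
        by simp
      finally have "m < i ({}, 1) + ennreal (\<eta> / 16)" .
      then show ?thesis
        using P_0 by (rule that[rotated])
    next
      case False
      then have "ennreal (mr - \<eta> / 16) < m"
        using mr U(3) by (simp add: ennreal_less_iff)
      then obtain p where "p \<in> P" "ennreal (mr - \<eta> / 16) < i p"
        by (auto simp: m_def less_SUP_iff)
      then have "ennreal (mr - \<eta> / 16) + ennreal (\<eta> / 16) < i p + ennreal (\<eta> / 16)"
        by (simp add: add.commute ennreal_add_left_cancel_less)
      also have "ennreal (mr - \<eta> / 16) + ennreal (\<eta> / 16) = m"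
        using False U(3) mr by (simp flip: ennreal_plus)
      finally show ?thesis
        using \<open>p \<in> P\<close> by (intro that[of "fst p" "snd p"]) auto
    qed
    \<comment> \<open>\<open>3 * \<delta> < \<epsilon>\<close> keeps the midpoint \<open>k\<close>
      of \<open>g\<close> and \<open>h\<close> in \<open>N (V, \<epsilon>)\<close>, so
      \<open>e k\<close> is above \<open>mr - \<eta> / 16\<close>. The parallelogram identity then
      bounds the energy of \<open>g - h\<close> by
      \<open>4 * (mr + \<delta>) - 4 * (mr - \<eta> / 16)\<close>, which is at most
      \<open>\<eta> / 2\<close> by \<open>\<delta> \<le> \<eta> / 16\<close>.\<close>
    define \<delta> where "\<delta> = min (\<epsilon> / 4) (\<eta> / 16)"
    have "0 < \<epsilon>" and \<delta>: "0 < \<delta>" "3 * \<delta> < \<epsilon>" "\<delta> \<le> \<eta> / 16"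
      using V U(3) by (auto simp: P_def \<delta>_def)
    have p: "(U \<union> V, \<delta>) \<in> P"
      using V U \<delta> emeasure_Un_finite[of U M V] by (auto simp: P_def)
    have "(\<lambda>x. g x - h x) \<in> W" if g: "g \<in> S (U \<union> V, \<delta>)" and h: "h \<in> S (U \<union> V, \<delta>)" for g h
    proof (rule W)
      have gD: "g \<in> D" "h \<in> D" and gL: "g \<in> L0 M" "h \<in> L0 M"
        using g h S_D D_L0 by blast+
      show "(\<lambda>x. g x - h x) \<in> D"
        using gD by (rule D_diff)
      have dist: "meas_dist M A g f < ennreal \<delta>" "meas_dist M A h f < ennreal \<delta>"
        if "A \<subseteq> U \<union> V" for A
        using g h meas_dist_mono[OF that] by (auto simp: S_def N_def intro: le_less_trans)
      have dist_gh: "meas_dist M A g h \<le> ennreal (2 * \<delta>)" if "A \<subseteq> U \<union> V" "A \<in> sets M" for A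
      proof -
        have "meas_dist M A g h \<le> meas_dist M A g f + meas_dist M A f h"
          by (rule meas_dist_triangle) (use that gL f in auto)
        also have "\<dots> \<le> ennreal \<delta> + ennreal \<delta>"
          using dist[OF that(1)] by (intro add_mono) (auto simp: meas_dist_commute[of M A f])
        also have "\<dots> = ennreal (2 * \<delta>)"
          using \<delta> by (simp flip: ennreal_plus)
        finally show ?thesis .
      qed
      have "meas_dist M U (\<lambda>x. g x - h x) (\<lambda>x. 0) = meas_dist M U g h"
        by (simp add: meas_dist_def)
      also have "\<dots> \<le> ennreal (2 * \<delta>)"
        by (rule dist_gh) (use U in auto)
      also have "\<dots> < ennreal \<eta>"
        using \<delta> U(3) by (intro ennreal_lessI) auto
      finally show "meas_dist M U (\<lambda>x. g x - h x) (\<lambda>x. 0) < ennreal \<eta>" .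
      define k where "k = (\<lambda>x. (1 / 2) * (g x + h x))"
      have kD: "k \<in> D"
        unfolding k_def by (intro D_scale D_add gD)
      have "V \<in> sets M"
        using V by (auto simp: P_def)
      have "meas_dist M V k f \<le> meas_dist M V k h + meas_dist M V h f"
        by (rule meas_dist_triangle) (use \<open>V \<in> sets M\<close> gL f kD D_L0 in auto)
      also have "\<dots> \<le> ennreal (2 * \<delta>) + ennreal \<delta>"
      proof (intro add_mono)
        have "meas_dist M V k h \<le> meas_dist M V g h"
          unfolding meas_dist_def k_def
          by (intro nn_integral_mono mult_right_mono ennreal_leI) (auto simp: min_def abs_if field_simps)
        with dist_gh[of V] \<open>V \<in> sets M\<close> show "meas_dist M V k h \<le> ennreal (2 * \<delta>)"
          by auto
      qed (use dist(2)[of V] in auto)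
      also have "\<dots> < ennreal \<epsilon>"
        using \<delta> by (simp add: ennreal_less_iff flip: ennreal_plus)
      finally have "k \<in> N (V, \<epsilon>)"
        using kD D_L0 by (auto simp: N_def)
      then have "i (V, \<epsilon>) \<le> E k"
        unfolding i_def by (rule INF_lower)
      then have "m < E k + ennreal (\<eta> / 16)"
        using i_V by (meson add_right_mono order_less_le_trans)
      also have "\<dots> = ennreal (e k + \<eta> / 16)"
        using U(3) by (subst E_eq[OF kD]) (simp add: ennreal_plus)
      finally have "mr < e k + \<eta> / 16"
        using mr by (simp add: ennreal_less_iff)
      moreover have "e k = e (\<lambda>x. g x + h x) / 4"
        unfolding k_def using e_scale[OF D_add[OF gD], of "1 / 2"] by (simp add: power2_eq_square)
      moreover have "e g < mr + \<delta>" "e h < mr + \<delta>"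
        using g h E_less[OF gD(1) \<delta>(1)] E_less[OF gD(2) \<delta>(1)] by (auto simp: S_def)
      ultimately show "e (\<lambda>x. g x - h x) < \<eta>"
        using e_parallelogram[OF gD] \<delta> U(3) by linarith
    qed
    then show "\<forall>\<^sub>F (g, h) in F \<times>\<^sub>F F. (\<lambda>x. g x - h x) \<in> W"
      unfolding eventually_prod_filter
      by (intro exI[of _ "\<lambda>g. g \<in> S (U \<union> V, \<delta>)"]) (auto simp: ev intro: p)
  qed
  ultimately obtain h where lim: "limitin (form_topology M E) (\<lambda>g. g) h F"
    using closed unfolding closed_form_def vs_complete_def by blast
  then have hD: "h \<in> D"
    by (simp add: limitin_def topspace_form_topology)
  have near: "\<exists>g\<in>S (U, \<epsilon>). g \<in> D \<and> meas_dist M U g h < ennreal \<epsilon> \<and> e (\<lambda>x. g x - h x) < \<epsilon>"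
    if U: "(U, \<epsilon>) \<in> P" for U \<epsilon>
  proof -
    have "\<forall>\<^sub>F g in F. g \<in> {g \<in> D. meas_dist M U g h < ennreal \<epsilon>}"
      using lim U hD openin_form_ball_tau[of U \<epsilon> h]
      by (auto simp: limitin_def P_def meas_dist_self D_L0)
    moreover have "\<forall>\<^sub>F g in F. g \<in> {g \<in> D. e (\<lambda>x. g x - h x) < \<epsilon>}"
    proof -
      have "e (\<lambda>x. h x - h x) = 0"
        using e_scale[OF hD, of 0] by simp
      then show ?thesis
        using lim U hD openin_form_ball_seminorm[of \<epsilon> h] by (auto simp: limitin_def P_def)
    qed
    moreover have "\<forall>\<^sub>F g in F. g \<in> S (U, \<epsilon>)"
      using U by (auto simp: ev)
    ultimately have "\<forall>\<^sub>F g in F. g \<in> S (U, \<epsilon>) \<and> g \<in> D \<and> meas_dist M U g h < ennreal \<epsilon> \<and>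
        e (\<lambda>x. g x - h x) < \<epsilon>"
      by eventually_elim auto
    then show ?thesis
      using eventually_happens'[OF \<open>F \<noteq> bot\<close>] by blast
  qed
  have "AE x in M. h x = f x"
  proof (rule AE_eq_if_meas_dist_eq_0[OF semi_finite D_L0[OF hD] f])
    fix U assume U: "U \<in> sets M" "emeasure M U < \<infinity>"
    have "meas_dist M U h f \<le> 0 + ennreal \<epsilon>" if "0 < \<epsilon>" for \<epsilon>
    proof -
      have "(U, \<epsilon> / 2) \<in> P"
        using U that by (simp add: P_def)
      from near[OF this] obtain g where g: "g \<in> D" "meas_dist M U g h < ennreal (\<epsilon> / 2)"
        "meas_dist M U g f < ennreal (\<epsilon> / 2)"
        by (auto simp: S_def N_def)
      have "meas_dist M U h f \<le> meas_dist M U h g + meas_dist M U g f"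
        by (rule meas_dist_triangle) (use U f g hD D_L0 in auto)
      also have "\<dots> \<le> ennreal (\<epsilon> / 2) + ennreal (\<epsilon> / 2)"
        using g by (intro add_mono) (auto simp: meas_dist_commute[of M U h])
      finally show ?thesis
        using that by (simp flip: ennreal_plus)
    qed
    then show "meas_dist M U h f = 0"
      by (metis ennreal_le_epsilon le_zero_eq)
  qed
  then have Ef: "E f = E h"
    using E_cong_AE[OF D_L0[OF hD] f] by simp
  \<comment> \<open>\<open>h\<close> differs from some \<open>g\<close> of energy at most
    \<open>mr + \<delta>\<close> by a function of energy below \<open>\<delta>\<close>. In
    \<open>e_add_le\<close>, a large \<open>n\<close> makes \<open>mr / n\<close> at most
    \<open>\<epsilon> / 2\<close>, and the terms in \<delta> add up to
    \<open>(3 + n) * \<delta> = \<epsilon> / 2\<close>.\<close>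
  have "e h \<le> mr"
  proof (rule field_le_epsilon)
    fix \<epsilon> :: real assume \<epsilon>: "0 < \<epsilon>"
    obtain n where n: "2 * mr / \<epsilon> < real n"
      using reals_Archimedean2 by blast
    have "0 \<le> 2 * mr / \<epsilon>"
      using \<epsilon> mr by simp
    with n have pos: "0 < n"
      by linarith
    define \<delta> where "\<delta> = \<epsilon> / (2 * (3 + real n))"
    have \<delta>: "0 < \<delta>" "(3 + real n) * \<delta> = \<epsilon> / 2"
      using \<epsilon> by (simp_all add: \<delta>_def add_pos_nonneg divide_simps)
    have "({}, \<delta>) \<in> P"
      using \<delta> by (simp add: P_def)
    from near[OF this] obtain g where g: "g \<in> D" "E g < m + ennreal \<delta>" "e (\<lambda>x. g x - h x) < \<delta>"
      by (auto simp: S_def)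
    have "e g \<le> mr + \<delta>"
      using g E_less[OF g(1) \<delta>(1)] by auto
    then have "(1 + 1 / real n) * e g \<le> (1 + 1 / real n) * (mr + \<delta>)"
      by (intro mult_left_mono) auto
    also have "\<dots> \<le> mr + mr / real n + 2 * \<delta>"
      using pos \<delta>(1) by (simp add: distrib_right distrib_left divide_le_eq)
    also have "mr / real n \<le> \<epsilon> / 2"
      using n pos \<epsilon> by (simp add: field_simps)
    finally have 1: "(1 + 1 / real n) * e g \<le> mr + \<epsilon> / 2 + 2 * \<delta>"
      by simp
    have 2: "(1 + real n) * e (\<lambda>x. g x - h x) \<le> (1 + real n) * \<delta>"
      using g(3) by (intro mult_left_mono) auto
    have "e h \<le> (1 + 1 / real n) * e g + (1 + real n) * e (\<lambda>x. - (g x - h x))"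
      using e_add_le[OF g(1) _ pos, of "\<lambda>x. - (g x - h x)"] D_diff[OF hD g(1)] by simp
    also have "e (\<lambda>x. - (g x - h x)) = e (\<lambda>x. g x - h x)"
      by (intro e_minus D_diff g hD)
    finally show "e h \<le> mr + \<epsilon>"
      using 1 2 \<delta>(2) by (simp add: distrib_right)
  qed
  then have "E h \<le> m"
    using mr E_eq[OF hD] by (metis ennreal_leI)
  with m_le Ef show ?thesis
    by order
qed

lemma lower_semicontinuous_pointwise:
  assumes f: "\<And>n. f n \<in> L0 M" and g: "g \<in> L0 M"
    and lim: "\<And>x. x \<in> space M \<Longrightarrow> (\<lambda>n. f n x) \<longlonglongrightarrow> g x"
    and bound: "\<And>n. E (f n) \<le> C"
  shows "E g \<le> C"
proof (cases C)
  case (real c)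
  have "E g \<le> ennreal c"
  proof (rule lower_semicontinuous[OF g])
    fix U and \<delta> :: real assume U: "U \<in> sets M" "emeasure M U < \<infinity>" "0 < \<delta>"
    then have "\<forall>\<^sub>F n in sequentially. meas_dist M U (f n) g < ennreal \<delta>"
      using order_tendstoD(2)[OF meas_dist_tendsto_0[OF U(1,2) f g lim], of "ennreal \<delta>"] by simp
    then obtain n where "meas_dist M U (f n) g < ennreal \<delta>"
      using eventually_happens'[OF trivial_limit_sequentially] by blast
    with f bound real show "\<exists>h\<in>L0 M. meas_dist M U h g < ennreal \<delta> \<and> E h \<le> ennreal c"
      by blast
  qed
  with real show ?thesis by simp
qed simp

end

section \<open>Contraction properties of energy forms\<close>

lemma cutoff_dist:
  assumes "cutoff \<epsilon> C"
  shows "\<bar>C y - max 0 (min 1 y)\<bar> \<le> \<epsilon>"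
proof -
  have C: "mono C" "- \<epsilon> \<le> C y" "C y \<le> 1 + \<epsilon>" "\<And>x. 0 \<le> x \<Longrightarrow> x \<le> 1 \<Longrightarrow> C x = x"
    using assms by (auto simp: cutoff_def dest!: subsetD[OF _ rangeI[of C y]])
  have "C 0 = 0" "C 1 = 1"
    using C(4) by auto
  have "0 \<le> \<epsilon>"
    using \<open>C 0 = 0\<close> assms by (auto simp: cutoff_def dest!: subsetD[OF _ rangeI[of C 0]])
  consider "y < 0" | "0 \<le> y" "y \<le> 1" | "1 < y"
    by linarith
  then show ?thesis
  proof cases
    case 1
    then have "C y \<le> 0"
      using monoD[OF C(1), of y 0] \<open>C 0 = 0\<close> by simp
    with 1 C show ?thesis by simp
  next
    case 2
    with C(4) \<open>0 \<le> \<epsilon>\<close> show ?thesis by simp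
  next
    case 3
    then have "1 \<le> C y"
      using monoD[OF C(1), of 1 y] \<open>C 1 = 1\<close> by simp
    with 3 C show ?thesis by simp
  qed
qed

text \<open>Competitors for the equilibrium potential of \<open>A\<close>. The constraints hold at
  every point rather than almost everywhere, so that lattice operations and pointwise limits
  preserve them without exceptional sets.\<close>

definition unit_on :: "'a measure \<Rightarrow> 'a set \<Rightarrow> ('a \<Rightarrow> real) set" where
  "unit_on M A = {g \<in> L0 M. (\<forall>x. 0 \<le> g x \<and> g x \<le> 1) \<and> (\<forall>x\<in>A. g x = 1)}"

locale L0_energy_form = closed_L0_form +
  assumes markov: "markovian M E"
begin

text \<open>By \<open>cutoff_dist\<close> the cutoffs for \<epsilon> = 1/(n+1) converge uniformly to
  the clamp to [0,1], and lower semicontinuity carries the Markov inequality to the limit.\<close>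

lemma E_clamp_1:
  assumes f: "f \<in> L0 M"
  shows "E (\<lambda>x. max 0 (min 1 (f x))) \<le> E f"
proof -
  have "\<forall>n. \<exists>C. cutoff (inverse (real (Suc n))) C \<and> E (C \<circ> f) \<le> E f"
    using markov f unfolding markovian_def by (meson inverse_positive_iff_positive of_nat_0_less_iff zero_less_Suc)
  then obtain C where C: "\<And>n. cutoff (inverse (real (Suc n))) (C n)" "\<And>n. E (C n \<circ> f) \<le> E f"
    by metis
  show ?thesis
  proof (rule lower_semicontinuous_pointwise)
    fix n
    have "C n \<in> borel_measurable borel"
      using C(1)[of n] by (intro borel_measurable_mono) (simp add: cutoff_def)
    then show "C n \<circ> f \<in> L0 M"
      using f by (simp add: L0_def measurable_comp)
  next
    fix x
    have "(\<lambda>n. C n (f x) - max 0 (min 1 (f x))) \<longlonglongrightarrow> 0"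
      by (rule Lim_null_comparison[OF _ LIMSEQ_inverse_real_of_nat])
        (use cutoff_dist[OF C(1)] in auto)
    then show "(\<lambda>n. (C n \<circ> f) x) \<longlonglongrightarrow> max 0 (min 1 (f x))"
      by (simp add: LIM_zero_iff)
  qed (use C f L0_clamp in auto)
qed

lemma E_clamp:
  assumes f: "f \<in> L0 M" and c: "0 < c"
  shows "E (\<lambda>x. max 0 (min c (f x))) \<le> E f"
proof -
  let ?g = "\<lambda>x. max 0 (min 1 (1 / c * f x))"
  have g: "(\<lambda>x. 1 / c * f x) \<in> L0 M" "?g \<in> L0 M"
    using L0_scale[OF f, of "1 / c"] L0_clamp[OF L0_scale[OF f, of "1 / c"], of 1] by simp_all
  have "(\<lambda>x. max 0 (min c (f x))) = (\<lambda>x. c * ?g x)"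
    using c by (auto simp: fun_eq_iff max_def min_def field_simps)
  then have "E (\<lambda>x. max 0 (min c (f x))) = ennreal (c\<^sup>2) * E ?g"
    using E_scale[OF g(2)] by simp
  also have "\<dots> \<le> ennreal (c\<^sup>2) * E (\<lambda>x. 1 / c * f x)"
    by (intro mult_left_mono E_clamp_1 g) simp
  also have "\<dots> = E f"
    using E_scale[OF g(1), of c] c by simp
  finally show ?thesis .
qed

lemma E_pos_part:
  assumes f: "f \<in> L0 M"
  shows "E (\<lambda>x. max 0 (f x)) \<le> E f"
proof (rule lower_semicontinuous_pointwise)
  fix x
  obtain n where n: "f x \<le> real n"
    using real_arch_simple by blast
  have "\<forall>\<^sub>F k in sequentially. max 0 (min (real (Suc k)) (f x)) = max 0 (f x)"
    using eventually_ge_at_top[of n] by eventually_elim (use n in auto)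
  then show "(\<lambda>k. max 0 (min (real (Suc k)) (f x))) \<longlonglongrightarrow> max 0 (f x)"
    by (rule tendsto_eventually)
qed (use f in \<open>auto intro: L0_clamp L0_pos_part E_clamp\<close>)

text \<open>
  Perturbing \<open>f\<^sup>+\<close> by \<open>-f\<^sup>-/k\<close> does not change its positive part, so \<open>f\<^sup>+\<close> minimises the energy in
  this direction and \<open>E(f\<^sup>+, f\<^sup>-) \<le> 0\<close>.
\<close>

lemma E_abs:
  assumes f: "f \<in> L0 M"
  shows "E (\<lambda>x. \<bar>f x\<bar>) \<le> E f"
proof (cases "f \<in> D")
  case False
  then show ?thesis
    using f by (auto simp: form_domain_def not_less top_unique)
next
  case True
  \<comment> \<open>\<open>n\<close> is the negative part with its sign kept: \<open>f\<close> is
    \<open>p + n\<close> and its absolute value is \<open>p - n\<close>, so the claim amounts to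
    \<open>bilin E p n \<ge> 0\<close>.\<close>
  define p n where "p = (\<lambda>x. max 0 (f x))" and "n = (\<lambda>x. min 0 (f x))"
  have D: "p \<in> D" "n \<in> D"
  proof -
    show p: "p \<in> D"
      unfolding p_def using True E_pos_part[OF f] E_eq[OF True] f
      by (intro D_I[of _ "e f"]) (auto intro: L0_pos_part)
    have "n = (\<lambda>x. f x - p x)"
      by (auto simp: n_def p_def)
    then show "n \<in> D"
      using D_diff[OF True p] by simp
  qed
  have "0 \<le> bilin E p n"
  proof (rule bilin_nonneg_if_minimal[OF D])
    fix k :: nat assume k: "0 < k"
    have "p x = max 0 (p x + n x / real k)" for x
      using k by (cases "0 \<le> f x") (auto simp: p_def n_def divide_nonpos_nonneg)
    then have "p = (\<lambda>x. max 0 (p x + n x / real k))"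
      by auto
    moreover have "(\<lambda>x. p x + n x / real k) \<in> L0 M"
      using L0_add[OF D_L0[OF D(1)] L0_scale[OF D_L0[OF D(2)], of "1 / real k"]] by simp
    ultimately show "E p \<le> E (\<lambda>x. p x + n x / real k)"
      using E_pos_part[of "\<lambda>x. p x + n x / real k"] by simp
  qed
  moreover have eqs: "(\<lambda>x. p x + n x) = f" "(\<lambda>x. p x - n x) = (\<lambda>x. \<bar>f x\<bar>)"
    by (auto simp: p_def n_def)
  ultimately have "e (\<lambda>x. \<bar>f x\<bar>) \<le> e f"
    unfolding bilin_def by simp
  moreover have "(\<lambda>x. \<bar>f x\<bar>) \<in> D"
    using D_diff[OF D] eqs by simp
  ultimately show ?thesis
    using True by (simp add: E_le_iff)
qed

text \<open>With \<open>u\<close> the half sum and \<open>w\<close> the half difference,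
  \<open>f\<close> and \<open>g\<close> are \<open>u + w\<close> and \<open>u - w\<close>; replacing
  \<open>w\<close> by its absolute value yields the maximum and the minimum. The parallelogram
  identity reduces the claim to \<open>E_abs\<close>.\<close>

lemma E_min_max:
  assumes f: "f \<in> L0 M" and g: "g \<in> L0 M"
  shows "E (\<lambda>x. min (f x) (g x)) + E (\<lambda>x. max (f x) (g x)) \<le> E f + E g"
proof -
  define u w where "u = (\<lambda>x. (1 / 2) * (f x + g x))" and "w = (\<lambda>x. (1 / 2) * (f x - g x))"
  have uw: "u \<in> L0 M" "w \<in> L0 M"
    unfolding u_def w_def by (intro L0_scale L0_add L0_diff f g)+
  have eqs: "(\<lambda>x. u x + \<bar>w x\<bar>) = (\<lambda>x. max (f x) (g x))" "(\<lambda>x. u x - \<bar>w x\<bar>) = (\<lambda>x. min (f x) (g x))"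
    "(\<lambda>x. u x + w x) = f" "(\<lambda>x. u x - w x) = g"
    by (auto simp: u_def w_def fun_eq_iff max_def min_def abs_if field_simps)
  have "E (\<lambda>x. min (f x) (g x)) + E (\<lambda>x. max (f x) (g x)) = 2 * E u + 2 * E (\<lambda>x. \<bar>w x\<bar>)"
    using parallelogram[OF uw(1) L0_absI[OF uw(2)]] by (simp add: eqs add.commute)
  also have "\<dots> \<le> 2 * E u + 2 * E w"
    by (intro add_left_mono mult_left_mono E_abs uw) simp
  also have "\<dots> = E f + E g"
    using parallelogram[OF uw] by (simp add: eqs)
  finally show ?thesis .
qed

text \<open>
  By the lattice inequality \<open>E_min_max\<close>, infima over the tails of a fast minimising sequence are
  still almost minimising, so its pointwise limit inferior is a minimiser.
\<close>

lemma exists_minimizer: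
  assumes K_L0: "K \<subseteq> L0 M" and f0: "f0 \<in> K" "f0 \<in> D"
    and bounds: "\<And>f x. f \<in> K \<Longrightarrow> 0 \<le> f x" "\<And>f x. f \<in> K \<Longrightarrow> f x \<le> 1"
    and min_K: "\<And>f g. f \<in> K \<Longrightarrow> g \<in> K \<Longrightarrow> (\<lambda>x. min (f x) (g x)) \<in> K"
    and max_K: "\<And>f g. f \<in> K \<Longrightarrow> g \<in> K \<Longrightarrow> (\<lambda>x. max (f x) (g x)) \<in> K"
    and lim_K: "\<And>F f. (\<And>n. F n \<in> K) \<Longrightarrow> (\<And>x. (\<lambda>n. F n x) \<longlonglongrightarrow> f x) \<Longrightarrow> f \<in> K"
  shows "\<exists>h\<in>K. h \<in> D \<and> (\<forall>g\<in>K. E h \<le> E g)"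
proof -
  define m where "m = (INF g\<in>K. E g)"
  have m_le: "m \<le> E g" if "g \<in> K" for g
    unfolding m_def using that by (rule INF_lower)
  have "m \<le> ennreal (e f0)"
    using m_le[OF f0(1)] unfolding E_eq[OF f0(2), symmetric] .
  then obtain mr where mr: "m = ennreal mr" "0 \<le> mr"
    by (cases m) (auto simp: top_unique)
  have mr_le: "mr \<le> e g" if "g \<in> K" "g \<in> D" for g
    using m_le[OF that(1)] unfolding mr(1) by (subst (asm) E_eq[OF that(2)]) simp
  have "\<exists>g\<in>K. E g \<le> ennreal (mr + 1 / 2 ^ n)" for n
  proof -
    have "m < ennreal (mr + 1 / 2 ^ n)"
      using mr by (simp add: ennreal_less_iff)
    then show ?thesis
      unfolding m_def INF_less_iff by (auto intro: less_imp_le)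
  qed
  then obtain g where g: "\<And>n. g n \<in> K" "\<And>n. E (g n) \<le> ennreal (mr + 1 / 2 ^ n)"
    by metis
  have gD: "g n \<in> D" for n
    using D_I[OF _ g(2)] g(1) K_L0 by blast
  have e_g: "e (g n) \<le> mr + 1 / 2 ^ n" for n
    using g(2)[of n] mr by (intro enn2real_leI) auto
  \<comment> \<open>\<open>w N n\<close> is the minimum of \<open>g N\<close>, ...,
    \<open>g (N + n)\<close>.\<close>
  define w where "w N = rec_nat (g N) (\<lambda>n u x. min (u x) (g (N + Suc n) x))" for N
  have w_0: "w N 0 = g N" and w_Suc: "w N (Suc n) = (\<lambda>x. min (w N n x) (g (N + Suc n) x))" for N n
    by (simp_all add: w_def)
  have w_K: "w N n \<in> K" for N n
    by (induction n) (auto simp: w_0 w_Suc intro: g min_K)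
  \<comment> \<open>The excess over \<open>mr\<close> is the geometric sum of
    \<open>1 / 2 ^ j\<close> for \<open>j\<close> from \<open>N\<close> to \<open>N + n\<close>.
    Each new minimum adds at most the excess of the new \<open>g\<close>, because the corresponding
    maximum lies in \<open>K\<close> and has energy at least \<open>mr\<close>.\<close>
  have w_bound: "w N n \<in> D \<and> e (w N n) \<le> mr + 2 / 2 ^ N - 1 / 2 ^ (N + n)" for N n
  proof (induction n)
    case 0
    then show ?case
      using gD e_g[of N] by (simp add: w_0)
  next
    case (Suc n)
    let ?v = "\<lambda>x. max (w N n x) (g (N + Suc n) x)"
    have le: "E (w N (Suc n)) + E ?v \<le> ennreal (e (w N n) + e (g (N + Suc n)))"
    proof -
      have "E (w N (Suc n)) + E ?v \<le> E (w N n) + E (g (N + Suc n))"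
        unfolding w_Suc by (rule E_min_max) (use w_K g(1) K_L0 in blast)+
      also have "\<dots> = ennreal (e (w N n) + e (g (N + Suc n)))"
        using Suc gD by (simp only: ennreal_plus enn2real_nonneg flip: E_eq)
      finally show ?thesis .
    qed
    have L0: "w N (Suc n) \<in> L0 M" "?v \<in> L0 M"
      using w_K max_K g(1) K_L0 by blast+
    have wD: "w N (Suc n) \<in> D" and vD: "?v \<in> D"
      using D_I[OF L0(1) order_trans[OF _ le]] D_I[OF L0(2) order_trans[OF _ le]] by auto
    have "ennreal (e (w N (Suc n)) + e ?v) \<le> ennreal (e (w N n) + e (g (N + Suc n)))"
      using le wD vD by (simp only: ennreal_plus enn2real_nonneg flip: E_eq)
    then have "e (w N (Suc n)) + e ?v \<le> e (w N n) + e (g (N + Suc n))"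
      by (subst (asm) ennreal_le_iff) auto
    moreover have "mr \<le> e ?v"
      using vD w_K g max_K by (intro mr_le) auto
    ultimately have "e (w N (Suc n)) \<le> mr + 2 / 2 ^ N - 1 / 2 ^ (N + n) + 1 / 2 ^ (N + Suc n)"
      using Suc e_g[of "N + Suc n"] by linarith
    also have "\<dots> = mr + 2 / 2 ^ N - 1 / 2 ^ (N + Suc n)"
      by simp
    finally show ?case
      using wD by simp
  qed
  define k where "k N x = (INF n. w N n x)" for N x
  have bdd: "bdd_below (range (\<lambda>n. w N n x))" for N x
    using bounds(1)[OF w_K] by (intro bdd_belowI2[where m = 0])
  have w_lim: "(\<lambda>n. w N n x) \<longlonglongrightarrow> k N x" for N x
    unfolding k_def by (intro LIMSEQ_decseq_INF bdd decseq_SucI) (simp add: w_Suc)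
  have k_K: "k N \<in> K" for N
    using w_K w_lim by (rule lim_K)
  have E_k: "E (k N) \<le> ennreal (mr + 2 / 2 ^ N)" for N
  proof (rule lower_semicontinuous_pointwise)
    fix n
    have "e (w N n) \<le> mr + 2 / 2 ^ N"
      using w_bound[of N n] by (rule order_trans[OF conjunct2]) simp
    then show "E (w N n) \<le> ennreal (mr + 2 / 2 ^ N)"
      using w_bound[of N n] by (subst E_eq) (auto intro: ennreal_leI)
  qed (use w_K k_K K_L0 w_lim in auto)
  have k_mono: "k N x \<le> k (Suc N) x" for N x
    unfolding k_def[of "Suc N"]
  proof (rule cINF_greatest)
    fix n
    \<comment> \<open>The recursion extends the range at its end; splitting off its first member
      instead compares the tails from \<open>N\<close> and \<open>Suc N\<close>.\<close>
    have "w N (Suc n) x = min (g N x) (w (Suc N) n x)"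
      by (induction n) (auto simp: w_0 w_Suc)
    then show "k N x \<le> w (Suc N) n x"
      unfolding k_def using cINF_lower[OF bdd, of "Suc n" N x] by simp
  qed simp
  define h where "h x = (SUP N. k N x)" for x
  have k_lim: "(\<lambda>N. k N x) \<longlonglongrightarrow> h x" for x
    unfolding h_def using bounds(2)[OF k_K] k_mono
    by (intro LIMSEQ_incseq_SUP bdd_aboveI2[where M = 1] incseq_SucI) auto
  have h_K: "h \<in> K"
    using k_K k_lim by (rule lim_K)
  have E_h: "E h \<le> ennreal (mr + 2 / 2 ^ N)" for N
  proof (rule lower_semicontinuous_pointwise)
    show "(\<lambda>n. k (n + N) x) \<longlonglongrightarrow> h x" for x
      using k_lim by (rule LIMSEQ_ignore_initial_segment)
    show "E (k (n + N)) \<le> ennreal (mr + 2 / 2 ^ N)" for n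
      by (rule order_trans[OF E_k])
        (auto intro!: ennreal_leI divide_left_mono power_increasing)
  qed (use k_K h_K K_L0 in auto)
  have hD: "h \<in> D"
    using h_K K_L0 E_h by (blast intro: D_I)
  have lim: "(\<lambda>N. mr + 2 * (1 / 2) ^ N) \<longlonglongrightarrow> mr + 2 * 0"
    by (intro tendsto_intros LIMSEQ_power_zero) simp
  have le: "e h \<le> mr + 2 * (1 / 2) ^ N" for N
    using E_h[of N] mr by (intro enn2real_leI) (auto simp: power_divide)
  have "e h \<le> mr + 2 * 0"
    by (rule LIMSEQ_le_const[OF lim]) (use le in auto)
  then have "e h \<le> mr"
    by simp
  then have "E h \<le> m"
    unfolding mr(1) by (subst E_eq[OF hD]) (rule ennreal_leI)
  then show ?thesis
    using h_K hD m_le order_trans[of "E h" m] by blast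
qed

section \<open>Equilibrium potentials\<close>

lemma unit_on_clamp:
  assumes "f \<in> L0 M" "\<And>x. x \<in> A \<Longrightarrow> 1 \<le> f x"
  shows "(\<lambda>x. max 0 (min 1 (f x))) \<in> unit_on M A"
  using assms L0_clamp[of f 1] by (auto simp: unit_on_def)

text \<open>Adding a nonnegative \<open>\<psi> / n\<close> to the minimiser may break the bound 1,
  but clamping brings the sum back among the competitors without raising its energy. So the
  minimiser beats the unclamped sum as well, and the first variation applies.\<close>

lemma exists_superharmonic_unit_on:
  assumes f0: "f0 \<in> unit_on M A" "f0 \<in> D"
  shows "\<exists>h\<in>unit_on M A. superharmonic M E h \<and> (\<forall>g\<in>unit_on M A. E h \<le> E g)"
proof -
  have "\<exists>h\<in>unit_on M A. h \<in> D \<and> (\<forall>g\<in>unit_on M A. E h \<le> E g)"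
  proof (rule exists_minimizer[OF _ f0])
    fix F f assume F: "\<And>n. F n \<in> unit_on M A" and lim: "\<And>x. (\<lambda>n. F n x) \<longlonglongrightarrow> f x"
    have "f \<in> L0 M"
      unfolding L0_def
    proof (rule borel_measurable_LIMSEQ_real)
      show "(\<lambda>n. F n x) \<longlonglongrightarrow> f x" for x
        by (rule lim)
      show "F n \<in> borel_measurable M" for n
        using F[of n] by (simp add: unit_on_def L0_def)
    qed
    moreover have "0 \<le> f x" "f x \<le> 1" for x
      using F by (intro LIMSEQ_le_const[OF lim] LIMSEQ_le_const2[OF lim]; simp add: unit_on_def)+
    moreover have "f x = 1" if "x \<in> A" for x
      using F that by (intro LIMSEQ_unique[OF lim[of x]]) (simp add: unit_on_def)
    ultimately show "f \<in> unit_on M A"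
      by (simp add: unit_on_def)
  qed (auto simp: unit_on_def L0_minI L0_maxI min_le_iff_disj le_max_iff_disj)
  then obtain h where h: "h \<in> unit_on M A" "h \<in> D" and le: "\<And>g. g \<in> unit_on M A \<Longrightarrow> E h \<le> E g"
    by blast
  have "0 \<le> bilin E h \<psi>" if \<psi>: "\<psi> \<in> D" "AE x in M. 0 \<le> \<psi> x" for \<psi>
  proof (rule bilin_nonneg_if_minimal[OF h(2) \<psi>(1)])
    fix n :: nat assume n: "0 < n"
    let ?g = "\<lambda>x. h x + (1 / real n) * max 0 (\<psi> x)"
    have g: "?g \<in> L0 M"
      by (intro L0_add L0_scale L0_pos_part D_L0 h \<psi>)
    have "E h \<le> E (\<lambda>x. max 0 (min 1 (?g x)))"
      using h(1) by (intro le unit_on_clamp g) (auto simp: unit_on_def)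
    also have "\<dots> \<le> E ?g"
      using g by (rule E_clamp_1)
    also have "\<dots> = E (\<lambda>x. h x + \<psi> x / real n)"
    proof (rule E_cong_AE[OF g])
      show "(\<lambda>x. h x + \<psi> x / real n) \<in> L0 M"
        using L0_add[OF D_L0[OF h(2)] L0_scale[OF D_L0[OF \<psi>(1)], of "1 / real n"]] by simp
      show "AE x in M. ?g x = h x + \<psi> x / real n"
        using \<psi>(2) by eventually_elim simp
    qed
    finally show "E h \<le> E (\<lambda>x. h x + \<psi> x / real n)" .
  qed
  then have "superharmonic M E h"
    using h(2) by (simp add: superharmonic_def)
  with h(1) le show ?thesis
    by (intro bexI[of _ h]) auto
qed

lemma unit_on_bump:
  assumes f: "f \<in> D" and \<alpha>: "0 < \<alpha>"
  shows "(\<lambda>x. max 0 (min 1 (\<bar>f x\<bar> / \<alpha>))) \<in> unit_on M {x \<in> space M. \<alpha> \<le> \<bar>f x\<bar>} \<inter> D"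
proof -
  have f': "(\<lambda>x. \<bar>f x\<bar>) \<in> D"
    using E_abs[OF D_L0[OF f]] E_eq[OF f] f by (intro D_I[of _ "e f"] L0_absI D_L0[OF f]) simp
  then have g: "(\<lambda>x. \<bar>f x\<bar> / \<alpha>) \<in> D"
    using D_scale[OF f', of "1 / \<alpha>"] by simp
  then have "(\<lambda>x. max 0 (min 1 (\<bar>f x\<bar> / \<alpha>))) \<in> D"
    using E_clamp_1[OF D_L0[OF g]] E_eq[OF g]
    by (intro D_I[of _ "e (\<lambda>x. \<bar>f x\<bar> / \<alpha>)"] L0_clamp D_L0[OF g]) simp
  moreover have "1 \<le> \<bar>f x\<bar> / \<alpha>" if "x \<in> {x \<in> space M. \<alpha> \<le> \<bar>f x\<bar>}" for x
    using that \<alpha> by simp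
  then have "(\<lambda>x. max 0 (min 1 (\<bar>f x\<bar> / \<alpha>))) \<in> unit_on M {x \<in> space M. \<alpha> \<le> \<bar>f x\<bar>}"
    by (rule unit_on_clamp[OF D_L0[OF g]])
  ultimately show ?thesis
    by blast
qed

lemma superharmonic_imp_excessive:
  assumes "superharmonic M E h"
  shows "excessive M E h"
proof -
  have "{u. superharmonic M E u} \<subseteq> topspace (tau M)"
    by (auto simp: topspace_tau superharmonic_def form_domain_def)
  with assms show ?thesis
    unfolding excessive_def using closure_of_subset by blast
qed

lemma superharmonic_cong_AE:
  assumes h: "superharmonic M E h" and g: "g \<in> L0 M" and eq: "AE x in M. h x = g x"
  shows "superharmonic M E g"
proof -
  have hD: "h \<in> D"
    using h by (simp add: superharmonic_def)
  then have "E h = E g"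
    by (intro E_cong_AE D_L0 g eq)
  then have "g \<in> D"
    using hD g by (simp add: form_domain_def)
  moreover have "bilin E g \<psi> = bilin E h \<psi>" if "\<psi> \<in> D" for \<psi>
  proof -
    have "E (\<lambda>x. h x + \<psi> x) = E (\<lambda>x. g x + \<psi> x)"
      using eq by (intro E_cong_AE L0_add D_L0[OF hD] g D_L0[OF that]) auto
    moreover have "E (\<lambda>x. h x - \<psi> x) = E (\<lambda>x. g x - \<psi> x)"
      using eq by (intro E_cong_AE L0_diff D_L0[OF hD] g D_L0[OF that]) auto
    ultimately show ?thesis
      by (simp add: bilin_def)
  qed
  ultimately show ?thesis
    using h by (simp add: superharmonic_def)
qed

section \<open>Full support\<close>

text \<open>Makes the level sets upward directed: each bump is nonnegative and equals 1 on its own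
  level set, so the sum of two bumps is at least 1 on both.\<close>

lemma level_sets_directed:
  fixes f :: "nat \<Rightarrow> 'a \<Rightarrow> real" and \<alpha> :: "nat \<Rightarrow> real"
  assumes "\<And>i. f i \<in> D" "\<And>i. 0 < \<alpha> i"
  shows "\<exists>g\<in>D. (\<Union>i\<le>n. {x \<in> space M. \<alpha> i \<le> \<bar>f i x\<bar>}) \<subseteq> {x \<in> space M. 1 \<le> \<bar>g x\<bar>}"
proof (induction n)
  case 0
  show ?case
    using assms(1)[of 0] assms(2)[of 0] D_scale[OF assms(1)[of 0], of "1 / \<alpha> 0"]
    by (intro bexI[of _ "\<lambda>x. 1 / \<alpha> 0 * f 0 x"]) (auto simp: abs_mult)
next
  case (Suc n)
  then obtain g where g: "g \<in> D"
    "(\<Union>i\<le>n. {x \<in> space M. \<alpha> i \<le> \<bar>f i x\<bar>}) \<subseteq> {x \<in> space M. 1 \<le> \<bar>g x\<bar>}"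
    by blast
  define b c where "b = (\<lambda>x. max 0 (min 1 (\<bar>f (Suc n) x\<bar> / \<alpha> (Suc n))))"
    and "c = (\<lambda>x. max 0 (min 1 (\<bar>g x\<bar> / 1)))"
  have b: "b \<in> D" "b \<in> unit_on M {x \<in> space M. \<alpha> (Suc n) \<le> \<bar>f (Suc n) x\<bar>}"
    using unit_on_bump[OF assms] unfolding b_def by blast+
  have c: "c \<in> D" "c \<in> unit_on M {x \<in> space M. 1 \<le> \<bar>g x\<bar>}"
    using unit_on_bump[OF g(1), of 1] unfolding c_def by simp_all
  have "x \<in> {x \<in> space M. 1 \<le> \<bar>b x + c x\<bar>}"
    if x: "x \<in> (\<Union>i\<le>Suc n. {x \<in> space M. \<alpha> i \<le> \<bar>f i x\<bar>})" for x
  proof -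
    have "0 \<le> b x" "0 \<le> c x" and "x \<in> space M"
      using x by (auto simp: b_def c_def)
    moreover have "b x = 1 \<or> c x = 1"
    proof (cases "\<alpha> (Suc n) \<le> \<bar>f (Suc n) x\<bar>")
      case True
      with b(2) \<open>x \<in> space M\<close> show ?thesis by (simp add: unit_on_def)
    next
      case False
      with x have "x \<in> (\<Union>i\<le>n. {x \<in> space M. \<alpha> i \<le> \<bar>f i x\<bar>})"
        by (auto simp: le_Suc_eq)
      with g(2) have "x \<in> {x \<in> space M. 1 \<le> \<bar>g x\<bar>}"
        by blast
      with c(2) show ?thesis
        unfolding unit_on_def by blast
    qed
    ultimately show ?thesis by auto
  qed
  then have "(\<Union>i\<le>Suc n. {x \<in> space M. \<alpha> i \<le> \<bar>f i x\<bar>}) \<subseteq> {x \<in> space M. 1 \<le> \<bar>b x + c x\<bar>}"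
    by (rule subsetI)
  with D_add[OF b(1) c(1)] show ?case
    by (intro bexI[of _ "\<lambda>x. b x + c x"])
qed

lemma level_set_sets: "f \<in> L0 M \<Longrightarrow> {x \<in> space M. \<alpha> \<le> \<bar>f x\<bar>} \<in> sets M"
  unfolding L0_def by measurable

text \<open>An exhaustion argument inside \<open>U\<close>: countably many level sets approach the
  supremum \<open>s\<close> of the measures \<open>emeasure M (U \<inter> level p)\<close>. Their
  union covers \<open>U\<close> up to a null set, and by directedness a single level set covers
  almost as much.\<close>

lemma full_support_exhaust:
  assumes full: "full_support M E"
    and U: "U \<in> sets M" "emeasure M U < \<infinity>" and \<delta>: "0 < \<delta>"
  shows "\<exists>f\<in>D. emeasure M (U - {x \<in> space M. 1 \<le> \<bar>f x\<bar>}) < ennreal \<delta>"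
proof -
  define level where "level = (\<lambda>(f, \<alpha>). {x \<in> space M. (\<alpha>::real) \<le> \<bar>f x :: real\<bar>})"
  define I where "I = D \<times> {0::real<..}"
  define s where "s = (SUP p\<in>I. emeasure M (U \<inter> level p))"
  have sets: "level p \<in> sets M" if "p \<in> I" for p
    using that level_set_sets D_L0 by (auto simp: level_def I_def)
  have "(\<lambda>x. 0) \<in> D"
    using E_scale[OF L0_const, of 0 0] L0_const[of 0] by (simp add: form_domain_def)
  then have "I \<noteq> {}"
    by (auto simp: I_def intro!: exI[of _ "\<lambda>x. 0"] exI[of _ 1])
  from ennreal_SUP_countable_SUP[OF this, of "\<lambda>p. emeasure M (U \<inter> level p)"]
  obtain X :: "nat \<Rightarrow> ennreal" where X: "range X \<subseteq> (\<lambda>p. emeasure M (U \<inter> level p)) ` I"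
    "s = Sup (range X)"
    unfolding s_def by blast
  then have "\<forall>i. \<exists>p\<in>I. X i = emeasure M (U \<inter> level p)"
    by (meson imageE rangeI subsetD)
  then obtain p where p: "\<And>i. p i \<in> I" "\<And>i. X i = emeasure M (U \<inter> level (p i))"
    by metis
  have upper: "\<exists>g\<in>D. (\<Union>i\<le>n. level (q i)) \<subseteq> level (g, 1)" if "\<And>i. q i \<in> I" for q :: "nat \<Rightarrow> _" and n
    using level_sets_directed[of "\<lambda>i. fst (q i)" "\<lambda>i. snd (q i)" n] that
    by (auto simp: I_def level_def case_prod_unfold mem_Times_iff)
  have s_le: "s \<le> emeasure M U"
    unfolding s_def by (intro SUP_least emeasure_mono U) auto
  let ?L = "\<Union>i. level (p i)"
  have level_p: "level (p i) \<in> sets M" for i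
    by (intro sets p)
  then have L: "?L \<in> sets M"
    by auto
  have null: "emeasure M (level q - (?L \<union> (space M - U))) = 0" if q: "q \<in> I" for q
  proof -
    let ?R = "U \<inter> level q - ?L"
    \<comment> \<open>\<open>?R\<close> and \<open>U \<inter> level (p i)\<close> are disjoint and
      lie in one common level set, so their measures add up to at most \<open>s\<close>. As
      \<open>s\<close> is finite, taking the supremum over \<open>i\<close> forces \<open>?R\<close>
      to be null.\<close>
    have "emeasure M ?R + X i \<le> s" for i
    proof -
      let ?q = "\<lambda>j. if j = (0::nat) then q else p i"
      have "?q j \<in> I" for j
        using q p by simp
      from upper[of ?q 1, OF this] obtain g where g: "g \<in> D" "(\<Union>j\<le>1. level (?q j)) \<subseteq> level (g, 1)"
        by blast
      have sub: "level q \<subseteq> level (g, 1)" "level (p i) \<subseteq> level (g, 1)"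
        using UN_subset_iff[THEN iffD1, OF g(2), rule_format, of 0]
          UN_subset_iff[THEN iffD1, OF g(2), rule_format, of 1] by simp_all
      have gI: "(g, 1) \<in> I"
        using g by (simp add: I_def)
      have "emeasure M ?R + X i = emeasure M (?R \<union> (U \<inter> level (p i)))"
        unfolding p(2) using U sets[OF q] L sets[OF p(1)] by (intro plus_emeasure) auto
      also have "\<dots> \<le> emeasure M (U \<inter> level (g, 1))"
        using sub U sets[OF gI] by (intro emeasure_mono) auto
      also have "\<dots> \<le> s"
        unfolding s_def using gI by (rule SUP_upper)
      finally show ?thesis .
    qed
    then have "(SUP i. emeasure M ?R + X i) \<le> s"
      by (rule SUP_least)
    then have "emeasure M ?R + s \<le> s"
      unfolding X(2) by (simp add: ennreal_SUP_add_right)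
    moreover have "s < top"
      using le_less_trans[OF s_le] U(2) by simp
    ultimately have "emeasure M ?R = 0"
      by (cases s; cases "emeasure M ?R") (auto simp: top_unique simp flip: ennreal_plus)
    moreover have "level q - (?L \<union> (space M - U)) = ?R"
      using sets.sets_into_space[OF sets[OF q]] by auto
    ultimately show ?thesis by simp
  qed
  \<comment> \<open>The complement of \<open>U\<close> is adjoined so that the set contains every
    level set of the form up to a null set; full support then makes it conull, which inside
    \<open>U\<close> says that \<open>?L\<close> exhausts \<open>U\<close>.\<close>
  have "emeasure M (space M - (?L \<union> (space M - U))) = 0"
  proof -
    have "\<forall>A\<in>{{x \<in> space M. \<alpha> \<le> \<bar>f x\<bar>} | f \<alpha>. f \<in> D \<and> 0 < \<alpha>}.
        emeasure M (A - (?L \<union> (space M - U))) = 0"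
      using null by (auto simp: I_def level_def)
    moreover have "?L \<union> (space M - U) \<in> sets M"
      using L U by auto
    ultimately show ?thesis
      using full unfolding full_support_def ess_supremum_def by blast
  qed
  moreover have "space M - (?L \<union> (space M - U)) = U - ?L"
    using sets.sets_into_space[OF U(1)] by auto
  ultimately have zero: "emeasure M (U - ?L) = 0"
    by simp
  let ?T = "\<lambda>n. U - (\<Union>i\<le>n. level (p i))"
  have "(\<lambda>n. emeasure M (?T n)) \<longlonglongrightarrow> emeasure M (\<Inter>n. ?T n)"
  proof (rule Lim_emeasure_decseq)
    show "range ?T \<subseteq> sets M"
      using U level_p by auto
    show "decseq ?T"
      by (intro decseq_SucI Diff_mono UN_mono) auto
    show "emeasure M (?T n) \<noteq> \<infinity>" for n
      using le_less_trans[OF emeasure_mono[of "?T n" U M]] U by (simp add: less_top)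
  qed
  moreover have "(\<Inter>n. ?T n) = U - ?L"
    by auto
  ultimately have "(\<lambda>n. emeasure M (?T n)) \<longlonglongrightarrow> 0"
    using zero by simp
  then have "\<forall>\<^sub>F n in sequentially. emeasure M (?T n) < ennreal \<delta>"
    by (rule order_tendstoD(2)) (use \<delta> in simp)
  from eventually_happens'[OF trivial_limit_sequentially this]
  obtain n where n: "emeasure M (?T n) < ennreal \<delta>" ..
  obtain g where g: "g \<in> D" "(\<Union>i\<le>n. level (p i)) \<subseteq> level (g, 1)"
    using upper[of p n, OF p(1)] by blast
  have "emeasure M (U - level (g, 1)) \<le> emeasure M (?T n)"
    using g U level_p by (intro emeasure_mono) auto
  then have "emeasure M (U - level (g, 1)) < ennreal \<delta>"
    using n by (rule le_less_trans)
  with g(1) show ?thesis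
    by (intro bexI[of _ g]) (auto simp: level_def)
qed

lemma one_excessive:
  assumes "full_support M E"
  shows "excessive M E (\<lambda>x. 1)"
proof -
  have "\<exists>h\<in>{u. superharmonic M E u}. meas_dist M U h (\<lambda>x. 1) < ennreal \<delta>"
    if U: "U \<in> sets M" "emeasure M U < \<infinity>" and \<delta>: "0 < \<delta>" for U \<delta>
  proof -
    obtain f where f: "f \<in> D" and lt: "emeasure M (U - {x \<in> space M. 1 \<le> \<bar>f x\<bar>}) < ennreal \<delta>"
      using full_support_exhaust[OF assms U \<delta>] by blast
    let ?A = "{x \<in> space M. 1 \<le> \<bar>f x\<bar>}"
    obtain b where b: "b \<in> unit_on M ?A" "b \<in> D"
      using unit_on_bump[OF f zero_less_one] by blast
    obtain h where h: "h \<in> unit_on M ?A" "superharmonic M E h"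
      using exists_superharmonic_unit_on[OF b] by blast
    have "meas_dist M U h (\<lambda>x. 1) \<le> (\<integral>\<^sup>+x. indicator (U - ?A) x \<partial>M)"
      unfolding meas_dist_def using h(1)
      by (intro nn_integral_mono) (auto simp: unit_on_def indicator_def)
    also have "\<dots> = emeasure M (U - ?A)"
      using U level_set_sets[OF D_L0[OF f], of 1] by (intro nn_integral_indicator) auto
    finally show ?thesis
      using h(2) lt by auto
  qed
  moreover have "{u. superharmonic M E u} \<subseteq> L0 M"
    by (auto simp: superharmonic_def form_domain_def)
  ultimately show ?thesis
    unfolding excessive_def
    by (subst in_closure_of_tau_iff) (use L0_const in \<open>auto simp del: bex_simps mem_Collect_eq\<close>)
qed

section \<open>Recurrent forms\<close>

lemma const_kernel: "recurrent M E \<Longrightarrow> (\<lambda>x. c) \<in> form_kernel M E"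
  using E_scale[OF L0_const, of c 1] by (simp add: recurrent_def form_kernel_def L0_const)

lemma E_add_const: "recurrent M E \<Longrightarrow> f \<in> D \<Longrightarrow> E (\<lambda>x. f x + c) = E f"
  by (intro E_add_kernel const_kernel)

lemma D_const: "recurrent M E \<Longrightarrow> (\<lambda>x. c) \<in> D"
  using const_kernel[of c] by (simp add: form_kernel_def form_domain_def)

text \<open>The symmetric truncation is the clamp to [0, 2c] conjugated by the shift by
  \<open>c\<close>, and shifts preserve the energy of a recurrent form.\<close>

lemma E_truncate:
  assumes r: "recurrent M E" and f: "f \<in> D" and c: "0 < c"
  shows "E (\<lambda>x. max (- c) (min c (f x))) \<le> E f" "(\<lambda>x. max (- c) (min c (f x))) \<in> D"
proof -
  let ?g = "\<lambda>x. max 0 (min (2 * c) (f x + c))"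
  have fc: "(\<lambda>x. f x + c) \<in> D"
    using f r by (intro D_add D_const)
  have E_g: "E ?g \<le> E f"
    using E_clamp[OF D_L0[OF fc], of "2 * c"] c E_add_const[OF r f, of c] by simp
  then have g: "?g \<in> D"
    using f L0_clamp[OF D_L0[OF fc], of "2 * c"] by (auto simp: form_domain_def)
  have eq: "(\<lambda>x. max (- c) (min c (f x))) = (\<lambda>x. ?g x + - c)"
    by (auto simp: fun_eq_iff max_def min_def)
  show "E (\<lambda>x. max (- c) (min c (f x))) \<le> E f"
    unfolding eq E_add_const[OF r g] by (rule E_g)
  show "(\<lambda>x. max (- c) (min c (f x))) \<in> D"
    unfolding eq using g r by (intro D_add D_const)
qed

lemma truncate_tendsto: "(\<lambda>n. max (- real (Suc n)) (min (real (Suc n)) y)) \<longlonglongrightarrow> y"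
proof (rule tendsto_eventually)
  obtain n where n: "\<bar>y\<bar> \<le> real n"
    using real_arch_simple by blast
  show "\<forall>\<^sub>F k in sequentially. max (- real (Suc k)) (min (real (Suc k)) y) = y"
    using eventually_ge_at_top[of n] by eventually_elim (use n in auto)
qed

text \<open>
  Testing the superharmonic function \<open>h\<close> against \<open>c \<plusminus> t\<close>, where \<open>t\<close> is the truncation of \<open>h\<close> at
  level \<open>c\<close>, gives \<open>E(h, t) = 0\<close>. Hence \<open>E(h + t) \<le> 2 E(h)\<close>, while \<open>h + t\<close> tends to \<open>2 h\<close>.
\<close>

lemma recurrent_superharmonic_kernel:
  assumes r: "recurrent M E" and h: "superharmonic M E h"
  shows "E h = 0"
proof -
  have hD: "h \<in> D" and pos: "\<And>\<psi>. \<psi> \<in> D \<Longrightarrow> (\<And>x. 0 \<le> \<psi> x) \<Longrightarrow> 0 \<le> bilin E h \<psi>"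
    using h by (auto simp: superharmonic_def)
  define t where "t c = (\<lambda>x. max (- c) (min c (h x)))" for c
  have bound: "E (\<lambda>x. h x + t c x) \<le> ennreal (2 * e h)" if c: "0 < c" for c
  proof -
    have tD: "t c \<in> D" and e_t: "e (t c) \<le> e h"
      using E_truncate[OF r hD c] hD by (simp_all add: t_def E_le_iff)
    have t_bounds: "- c \<le> t c x" "t c x \<le> c" for x
      using c by (auto simp: t_def)
    note sumD = D_add[OF hD tD] D_diff[OF hD tD]
    have add: "(\<lambda>x. h x + (t c x + c)) = (\<lambda>x. (h x + t c x) + c)"
      "(\<lambda>x. h x - (t c x + c)) = (\<lambda>x. (h x - t c x) + - c)"
      "(\<lambda>x. h x + (- t c x + c)) = (\<lambda>x. (h x - t c x) + c)"
      "(\<lambda>x. h x - (- t c x + c)) = (\<lambda>x. (h x + t c x) + - c)"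
      by auto
    have "0 \<le> bilin E h (\<lambda>x. t c x + c)"
    proof (rule pos)
      show "0 \<le> t c x + c" for x
        using t_bounds(1)[of x] by simp
    qed (intro D_add tD D_const r)
    moreover have "0 \<le> bilin E h (\<lambda>x. - t c x + c)"
    proof (rule pos)
      show "0 \<le> - t c x + c" for x
        using t_bounds(2)[of x] by simp
      show "(\<lambda>x. - t c x + c) \<in> D"
        using D_diff[OF D_const[OF r, of c] tD] by simp
    qed
    \<comment> \<open>The shifts by \<open>c\<close> drop out of the energies, so the two
      inequalities bound \<open>bilin E h (t c)\<close> from both sides by 0.\<close>
    ultimately have "e (\<lambda>x. h x + t c x) = e (\<lambda>x. h x - t c x)"
      unfolding bilin_def add E_add_const[OF r sumD(1)] E_add_const[OF r sumD(2)] by simp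
    then have "e (\<lambda>x. h x + t c x) \<le> 2 * e h"
      using e_parallelogram[OF hD tD] e_t by linarith
    then show ?thesis
      by (subst E_eq[OF sumD(1)]) (rule ennreal_leI)
  qed
  have "E (\<lambda>x. 2 * h x) \<le> ennreal (2 * e h)"
  proof (rule lower_semicontinuous_pointwise)
    show "(\<lambda>x. h x + t (real (Suc n)) x) \<in> L0 M" for n
      using E_truncate(2)[OF r hD, of "real (Suc n)"] unfolding t_def by (intro L0_add D_L0[OF hD] D_L0) simp
    show "(\<lambda>x. 2 * h x) \<in> L0 M"
      by (intro L0_scale D_L0 hD)
    show "(\<lambda>n. h x + t (real (Suc n)) x) \<longlonglongrightarrow> 2 * h x" for x
      using tendsto_add[OF tendsto_const[of "h x"] truncate_tendsto[of "h x"]]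
      unfolding t_def by simp
    show "E (\<lambda>x. h x + t (real (Suc n)) x) \<le> ennreal (2 * e h)" for n
      by (rule bound) simp
  qed
  then have "e (\<lambda>x. 2 * h x) \<le> 2 * e h"
    by (intro enn2real_leI) auto
  \<comment> \<open>The left side of the previous estimate is \<open>4 * e h\<close>.\<close>
  then have "e h = 0"
    using e_scale[OF hD, of 2] enn2real_nonneg[of "E h"] by simp
  then show ?thesis
    by (subst E_eq[OF hD]) simp
qed

lemma recurrent_excessive_kernel:
  assumes r: "recurrent M E" and h: "excessive M E h"
  shows "h \<in> form_kernel M E"
proof -
  have sub: "{u. superharmonic M E u} \<subseteq> L0 M"
    by (auto simp: superharmonic_def form_domain_def)
  have hL: "h \<in> L0 M" and near: "\<And>U \<delta>. U \<in> sets M \<Longrightarrow> 0 < \<delta> \<Longrightarrow> emeasure M U < \<infinity> \<Longrightarrow>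
      \<exists>g. superharmonic M E g \<and> meas_dist M U g h < ennreal \<delta>"
    using h unfolding excessive_def in_closure_of_tau_iff[OF sub] by auto
  have "E h \<le> ennreal 0"
  proof (rule lower_semicontinuous[OF hL])
    fix U and \<delta> :: real assume "U \<in> sets M" "emeasure M U < \<infinity>" "0 < \<delta>"
    then obtain g where g: "superharmonic M E g" "meas_dist M U g h < ennreal \<delta>"
      using near by blast
    then show "\<exists>g\<in>L0 M. meas_dist M U g h < ennreal \<delta> \<and> E g \<le> ennreal 0"
      using recurrent_superharmonic_kernel[OF r g(1)] sub by (intro bexI[of _ g]) auto
  qed
  with hL show ?thesis
    by (simp add: form_kernel_def)
qed

section \<open>Level sets of kernel elements and invariant sets\<close>

text \<open>The indicator is the pointwise limit of the clamps of \<open>n (f - c) + 1\<close>, and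
  these affine functions of \<open>f\<close> have energy 0. The summand 1 puts the points with
  \<open>f x = c\<close> into the limit set.\<close>

lemma recurrent_level_set:
  assumes r: "recurrent M E" and f: "f \<in> form_kernel M E"
  shows "E (indicator {x \<in> space M. c \<le> f x}) = 0"
proof -
  have fL: "f \<in> L0 M" and fD: "f \<in> D" and "E f = 0"
    using f by (auto simp: form_kernel_def form_domain_def)
  let ?u = "\<lambda>n x. real n * f x + (1 - real n * c)"
  have u: "?u n \<in> L0 M" for n
    by (intro L0_add L0_scale L0_const fL)
  have "E (indicator {x \<in> space M. c \<le> f x}) \<le> 0"
  proof (rule lower_semicontinuous_pointwise)
    show "(\<lambda>x. max 0 (min 1 (?u n x))) \<in> L0 M" for n
      using u by (rule L0_clamp)
    show "indicator {x \<in> space M. c \<le> f x} \<in> L0 M"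
      using fL unfolding L0_def by measurable
    show "E (\<lambda>x. max 0 (min 1 (?u n x))) \<le> 0" for n
    proof -
      have "E (\<lambda>x. max 0 (min 1 (?u n x))) \<le> E (?u n)"
        using u by (rule E_clamp_1)
      also have "\<dots> = E (\<lambda>x. real n * f x)"
        by (intro E_add_const r D_scale fD)
      also have "\<dots> = 0"
        using E_scale[OF fL] \<open>E f = 0\<close> by simp
      finally show ?thesis .
    qed
    fix x assume x: "x \<in> space M"
    have "\<forall>\<^sub>F n in sequentially. max 0 (min 1 (?u n x)) = indicator {x \<in> space M. c \<le> f x} x"
    proof (cases "c \<le> f x")
      case True
      then have "1 \<le> ?u n x" for n
        using mult_left_mono[of c "f x" "real n"] by simp
      with True x show ?thesis by (intro always_eventually) (simp add: min_def)
    next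
      case False
      obtain k where k: "1 / (c - f x) \<le> real k"
        using real_arch_simple by blast
      show ?thesis
        using eventually_ge_at_top[of k]
      proof eventually_elim
        case (elim n)
        have "1 / (c - f x) \<le> real n"
          using k elim by linarith
        then have "1 \<le> real n * (c - f x)"
          using False by (simp add: divide_le_eq)
        then have "?u n x \<le> 0"
          by (simp add: right_diff_distrib)
        with False show ?case by simp
      qed
    qed
    then show "(\<lambda>n. max 0 (min 1 (?u n x))) \<longlonglongrightarrow> indicator {x \<in> space M. c \<le> f x} x"
      by (rule tendsto_eventually)
  qed
  then show ?thesis by simp
qed

text \<open>
  For \<open>\<bar>g\<bar> \<le> c\<close>, adding the kernel element \<open>2 c 1\<^sub>A - c\<close> moves \<open>g\<close> on \<open>A\<close> above \<open>0\<close> and off \<open>A\<close> below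
  \<open>0\<close>; taking the absolute value then flips the sign of \<open>g\<close> off \<open>A\<close>, up to the constant \<open>c\<close>.
\<close>

lemma recurrent_sign_flip:
  assumes r: "recurrent M E" and A: "indicator A \<in> form_kernel M E" and g: "g \<in> D"
  shows "E (\<lambda>x. (2 * indicator A x - 1) * g x) \<le> E g"
proof -
  let ?\<sigma> = "\<lambda>x. 2 * indicator A x - 1 :: real"
  have A_L0: "indicator A \<in> L0 M" and A_D: "(indicator A :: 'a \<Rightarrow> real) \<in> D"
    using A by (auto simp: form_kernel_def form_domain_def)
  have \<sigma>_L0: "(\<lambda>x. ?\<sigma> x * g x) \<in> L0 M" if "g \<in> L0 M" for g
    using that A_L0 unfolding L0_def by measurable
  have bounded: "E (\<lambda>x. ?\<sigma> x * g x) \<le> E g" if g: "g \<in> D" and c: "\<And>x. \<bar>g x\<bar> \<le> c" for g c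
  proof -
    let ?k = "\<lambda>x. 2 * c * indicator A x"
    have k: "?k \<in> form_kernel M E"
      using A E_scale[OF A_L0, of "2 * c"] L0_scale[OF A_L0, of "2 * c"] by (simp add: form_kernel_def)
    have gk: "(\<lambda>x. g x + ?k x) \<in> D"
      by (intro D_add g D_scale A_D)
    let ?u = "\<lambda>x. g x + ?k x + - c"
    have u: "?u \<in> D"
      by (intro D_add[OF gk] D_const r)
    have E_u: "E ?u = E g"
      unfolding E_add_const[OF r gk] using g k by (rule E_add_kernel)
    have abs_u: "E (\<lambda>x. \<bar>?u x\<bar>) \<le> E ?u"
      using D_L0[OF u] by (rule E_abs)
    then have abs_u_D: "(\<lambda>x. \<bar>?u x\<bar>) \<in> D"
      using u L0_absI[OF D_L0[OF u]] by (auto simp: form_domain_def)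
    have "?\<sigma> x * g x = \<bar>?u x\<bar> + - c" for x
      using c[of x] by (auto simp: indicator_def abs_if split: if_splits)
    then have "E (\<lambda>x. ?\<sigma> x * g x) = E (\<lambda>x. \<bar>?u x\<bar> + - c)"
      by presburger
    also have "\<dots> = E (\<lambda>x. \<bar>?u x\<bar>)"
      by (rule E_add_const[OF r abs_u_D])
    finally show ?thesis
      using abs_u E_u by simp
  qed
  show ?thesis
  proof (rule lower_semicontinuous_pointwise)
    fix n
    let ?t = "\<lambda>x. max (- real (Suc n)) (min (real (Suc n)) (g x))"
    have t: "?t \<in> D" "E ?t \<le> E g"
      using E_truncate[OF r g, of "real (Suc n)"] by simp_all
    show "(\<lambda>x. ?\<sigma> x * ?t x) \<in> L0 M"
      using t D_L0 \<sigma>_L0 by blast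
    have "E (\<lambda>x. ?\<sigma> x * ?t x) \<le> E ?t"
      by (rule bounded[OF t(1), of "real (Suc n)"]) auto
    with t(2) show "E (\<lambda>x. ?\<sigma> x * ?t x) \<le> E g"
      by order
  next
    show "(\<lambda>n. ?\<sigma> x * max (- real (Suc n)) (min (real (Suc n)) (g x))) \<longlonglongrightarrow> ?\<sigma> x * g x" for x
      by (intro tendsto_intros truncate_tendsto)
  qed (use \<sigma>_L0 D_L0 g in blast)
qed

text \<open>Flipping the sign off \<open>A\<close> is an involution, so the inequality of
  \<open>recurrent_sign_flip\<close> is an equality. The two restrictions of \<open>g\<close> have
  sum \<open>g\<close> and difference the flipped \<open>g\<close>, and the parallelogram identity
  gives the splitting.\<close>

lemma recurrent_kernel_indicator_invariant:
  assumes r: "recurrent M E" and A: "A \<in> sets M" "indicator A \<in> form_kernel M E"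
  shows "form_invariant M E A"
  unfolding form_invariant_def
proof (intro conjI ballI)
  fix g assume g: "g \<in> D"
  let ?\<sigma> = "\<lambda>x. 2 * indicator A x - 1 :: real"
  let ?u = "\<lambda>x. indicator A x * g x" and ?v = "\<lambda>x. indicator (space M - A) x * g x"
  have [measurable]: "A \<in> sets M" "g \<in> borel_measurable M"
    using A D_L0[OF g] by (auto simp: L0_def)
  have L0: "?u \<in> L0 M" "?v \<in> L0 M" "(\<lambda>x. ?\<sigma> x * g x) \<in> L0 M"
    unfolding L0_def by measurable
  have le: "E (\<lambda>x. ?\<sigma> x * g x) \<le> E g"
    using recurrent_sign_flip[OF r A(2) g] .
  have flip_D: "(\<lambda>x. ?\<sigma> x * g x) \<in> D"
    using le_less_trans[OF le] g L0(3) by (simp add: form_domain_def)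
  have "(\<lambda>x. ?\<sigma> x * (?\<sigma> x * g x)) = g"
    by (simp add: fun_eq_iff indicator_def)
  from arg_cong[OF this, of E, symmetric] recurrent_sign_flip[OF r A(2) flip_D]
  have "E g \<le> E (\<lambda>x. ?\<sigma> x * g x)"
    by (rule ord_eq_le_trans)
  with le have \<sigma>: "E (\<lambda>x. ?\<sigma> x * g x) = E g"
    by (rule antisym)
  \<comment> \<open>The functions agree only on \<open>space M\<close>: outside it both indicators
    vanish.\<close>
  have "E (\<lambda>x. ?u x + ?v x) = E g"
    using L0 D_L0[OF g] by (intro E_cong_AE L0_add AE_I2) (auto simp: indicator_def)
  moreover have "E (\<lambda>x. ?u x - ?v x) = E (\<lambda>x. ?\<sigma> x * g x)"
    using L0 by (intro E_cong_AE L0_diff AE_I2) (auto simp: indicator_def)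
  ultimately have "2 * (E ?u + E ?v) = 2 * E g"
    using parallelogram[OF L0(1,2)] \<sigma> by (simp only: distrib_left mult_2)
  then show "E g = E ?u + E ?v"
    by (simp only: ennreal_mult_cancel_left) auto
qed (fact A)

end

text \<open>The constant is the supremum of the levels that \<open>f\<close> reaches almost
  everywhere.\<close>

lemma ae_constant_if_no_level_splits:
  fixes f :: "'a \<Rightarrow> real"
  assumes "\<And>c. (AE x in M. c \<le> f x) \<or> (AE x in M. f x < c)"
  shows "ae_constant M f"
proof -
  define S where "S = {c. AE x in M. c \<le> f x}"
  consider "S = UNIV" | "S = {}" | a b where "a \<in> S" "b \<notin> S"
    by blast
  then show ?thesis
  proof cases
    \<comment> \<open>Here and in the next case the bounds on \<open>f\<close> contradict each other
      almost everywhere, so the measure is zero and any constant serves.\<close>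
    case 1
    then have "AE x in M. real n \<le> f x" for n
      by (auto simp: S_def)
    then have "AE x in M. \<forall>n. real n \<le> f x"
      by (simp add: AE_all_countable)
    then have "AE x in M. f x = 0"
      by eventually_elim (meson not_less reals_Archimedean2)
    then show ?thesis
      by (auto simp: ae_constant_def)
  next
    case 2
    then have "AE x in M. f x < - real n" for n
      using assms[of "- real n"] by (auto simp: S_def)
    then have "AE x in M. \<forall>n. f x < - real n"
      by (simp add: AE_all_countable)
    then have "AE x in M. f x = 0"
    proof eventually_elim
      case (elim x)
      obtain n where "- f x < real n"
        using reals_Archimedean2 by blast
      with elim[rule_format, of n] show ?case by linarith
    qed
    then show ?thesis
      by (auto simp: ae_constant_def)
  next
    case 3
    have down: "c \<in> S" if "c \<le> d" "d \<in> S" for c d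
      using that by (auto simp: S_def elim: eventually_mono)
    have bdd: "bdd_above S"
      using 3 down by (intro bdd_aboveI[of _ b]) (meson linear)
    have "AE x in M. Sup S - inverse (real (Suc n)) \<le> f x \<and> f x < Sup S + inverse (real (Suc n))" for n
    proof (rule AE_conjI)
      obtain s where "s \<in> S" "Sup S - inverse (real (Suc n)) < s"
        using less_cSup_iff[of S "Sup S - inverse (real (Suc n))"] 3 bdd by auto
      then have "Sup S - inverse (real (Suc n)) \<in> S"
        using down by (meson less_imp_le)
      then show "AE x in M. Sup S - inverse (real (Suc n)) \<le> f x"
        by (simp add: S_def)
      have "Sup S + inverse (real (Suc n)) \<notin> S"
        using cSup_upper[OF _ bdd, of "Sup S + inverse (real (Suc n))"] by auto
      then show "AE x in M. f x < Sup S + inverse (real (Suc n))"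
        using assms[of "Sup S + inverse (real (Suc n))"] by (simp add: S_def)
    qed
    then have "AE x in M. \<forall>n. Sup S - inverse (real (Suc n)) \<le> f x \<and> f x < Sup S + inverse (real (Suc n))"
      by (simp add: AE_all_countable)
    then have "AE x in M. f x = Sup S"
    proof eventually_elim
      case (elim x)
      have "\<not> 0 < \<bar>f x - Sup S\<bar>"
      proof
        assume "0 < \<bar>f x - Sup S\<bar>"
        then obtain n where "inverse (real (Suc n)) < \<bar>f x - Sup S\<bar>"
          using reals_Archimedean by blast
        with elim[rule_format, of n] show False by linarith
      qed
      then show ?case by simp
    qed
    then show ?thesis
      by (auto simp: ae_constant_def)
  qed
qed

context L0_energy_form
begin

lemma recurrent_irreducible_kernel_constant:
  assumes r: "recurrent M E" and irr: "irreducible_form M E" and f: "f \<in> form_kernel M E"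
  shows "ae_constant M f"
proof (rule ae_constant_if_no_level_splits)
  fix c
  let ?A = "{x \<in> space M. c \<le> f x}"
  have [measurable]: "f \<in> borel_measurable M"
    using f by (simp add: form_kernel_def L0_def)
  have A: "?A \<in> sets M" and "(indicator ?A :: 'a \<Rightarrow> real) \<in> L0 M"
    unfolding L0_def by measurable
  then have "form_invariant M E ?A"
    using recurrent_level_set[OF r f, of c]
    by (intro recurrent_kernel_indicator_invariant r) (auto simp: form_kernel_def)
  then consider "emeasure M ?A = 0" | "emeasure M (space M - ?A) = 0"
    using irr by (auto simp: irreducible_form_def)
  then show "(AE x in M. c \<le> f x) \<or> (AE x in M. f x < c)"
  proof cases
    case 1
    then have "AE x in M. f x < c"
      using A by (intro AE_I[of _ _ ?A]) auto
    then show ?thesis ..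
  next
    case 2
    then have "AE x in M. c \<le> f x"
      using A by (intro AE_I[of _ _ "space M - ?A"]) auto
    then show ?thesis ..
  qed
qed

section \<open>Forms whose excessive functions are constant\<close>

text \<open>A constant equilibrium potential must be 1, as it equals 1 on a level set that is not
  null. So 1 itself is superharmonic and minimises the energy among the competitors, and the
  variation towards \<open>g\<close> gives the inequality.\<close>

lemma one_equilibrium:
  assumes const: "\<And>h. excessive M E h \<Longrightarrow> ae_constant M h"
    and f: "f \<in> D" and \<alpha>: "0 < \<alpha>" and nontrivial: "\<not> (AE x in M. \<bar>f x\<bar> < \<alpha>)"
    and g: "g \<in> D" "g \<in> unit_on M {x \<in> space M. \<alpha> \<le> \<bar>f x\<bar>}"
  shows "superharmonic M E (\<lambda>x. 1)" "e (\<lambda>x. 1) \<le> bilin E (\<lambda>x. 1) g"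
proof -
  let ?A = "{x \<in> space M. \<alpha> \<le> \<bar>f x\<bar>}"
  obtain h where h: "h \<in> unit_on M ?A" "superharmonic M E h"
    and h_le: "\<And>g. g \<in> unit_on M ?A \<Longrightarrow> E h \<le> E g"
    using exists_superharmonic_unit_on[OF g(2,1)] by blast
  obtain c where c: "AE x in M. h x = c"
    using const[OF superharmonic_imp_excessive[OF h(2)]] by (auto simp: ae_constant_def)
  have "c = 1"
  proof (rule ccontr)
    assume "c \<noteq> 1"
    from c have "AE x in M. \<bar>f x\<bar> < \<alpha>"
      using AE_space
    proof eventually_elim
      case (elim x)
      then have "x \<notin> ?A"
        using h(1) \<open>c \<noteq> 1\<close> unfolding unit_on_def by auto
      with elim show ?case by auto
    qed
    with nontrivial show False ..
  qed
  with c have h_1: "AE x in M. h x = 1"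
    by simp
  show sup: "superharmonic M E (\<lambda>x. 1)"
    by (rule superharmonic_cong_AE[OF h(2) L0_const h_1])
  have "E h = E (\<lambda>x. 1)"
    using h(1) h_1 by (intro E_cong_AE L0_const) (auto simp: unit_on_def)
  with h_le have min: "\<And>g. g \<in> unit_on M ?A \<Longrightarrow> E (\<lambda>x. 1) \<le> E g"
    by simp
  have one: "(\<lambda>x. 1) \<in> D"
    using sup by (simp add: superharmonic_def)
  \<comment> \<open>\<open>1 + (g - 1) / n\<close> is a convex combination of 1 and
    \<open>g\<close>, hence again a competitor.\<close>
  have "0 \<le> bilin E (\<lambda>x. 1) (\<lambda>x. g x - 1)"
  proof (rule bilin_nonneg_if_minimal[OF one D_diff[OF g(1) one]])
    fix n :: nat assume n: "0 < n"
    have "(\<lambda>x. 1 + (g x - 1) / real n) \<in> L0 M"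
      using g(1) D_L0 unfolding L0_def by auto
    moreover have "0 \<le> 1 + (g x - 1) / real n" "1 + (g x - 1) / real n \<le> 1" for x
      using g(2) n by (auto simp: unit_on_def field_simps intro: add_increasing2)
    moreover have "1 + (g x - 1) / real n = 1" if "x \<in> ?A" for x
      using g(2) that by (simp add: unit_on_def)
    ultimately show "E (\<lambda>x. 1) \<le> E (\<lambda>x. 1 + (g x - 1) / real n)"
      by (intro min) (simp add: unit_on_def)
  qed
  then show "e (\<lambda>x. 1) \<le> bilin E (\<lambda>x. 1) g"
    using bilin_diff[OF one g(1) one] bilin_self[OF one] by simp
qed

text \<open>
  If all equilibrium potentials equal \<open>1\<close>, then \<open>E(1, g) \<ge> E(1)\<close> for every \<open>0 \<le> g \<le> 1\<close> in the
  domain that equals \<open>1\<close> on a nontrivial level set. For a nonconstant such \<open>g\<close> this gives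
  \<open>E(1, 1 - g) = 0\<close>, so \<open>E(1, \<cdot>) = 0\<close> on truncated multiples of \<open>1 - g\<close> as well, and one of them
  again attains \<open>1\<close>. Hence \<open>E(1) = 0\<close>.
\<close>

lemma recurrent_if_excessive_constant:
  assumes const: "\<And>h. excessive M E h \<Longrightarrow> ae_constant M h"
    and f0: "f0 \<in> D" "\<not> ae_constant M f0"
  shows "recurrent M E"
proof -
  have pos_part: "(\<lambda>x. max 0 (f x)) \<in> D" if "f \<in> D" for f
    using E_pos_part[OF D_L0[OF that]] L0_pos_part[OF D_L0[OF that]] that
    by (auto simp: form_domain_def)
  \<comment> \<open>If \<open>max 0 f0\<close> and \<open>max 0 (- f0)\<close> were both constant,
    so would be their difference \<open>f0\<close>.\<close>
  obtain f where f: "f \<in> D" "\<And>x. 0 \<le> f x" "\<not> ae_constant M f"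
  proof (cases "ae_constant M (\<lambda>x. max 0 (f0 x))")
    case False
    with f0 pos_part[of f0] show ?thesis
      by (intro that[of "\<lambda>x. max 0 (f0 x)"]) auto
  next
    case True
    then obtain c where c: "AE x in M. max 0 (f0 x) = c"
      by (auto simp: ae_constant_def)
    have "\<not> ae_constant M (\<lambda>x. max 0 (- f0 x))"
    proof
      assume "ae_constant M (\<lambda>x. max 0 (- f0 x))"
      then obtain d where "AE x in M. max 0 (- f0 x) = d"
        by (auto simp: ae_constant_def)
      with c have "AE x in M. f0 x = c - d"
        by eventually_elim auto
      with f0(2) show False
        by (auto simp: ae_constant_def)
    qed
    moreover have "(\<lambda>x. max 0 (- f0 x)) \<in> D"
      using pos_part[of "\<lambda>x. - f0 x"] D_scale[OF f0(1), of "-1"] by simp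
    ultimately show ?thesis
      by (intro that[of "\<lambda>x. max 0 (- f0 x)"]) auto
  qed
  then obtain \<alpha> where \<alpha>: "\<not> (AE x in M. \<alpha> \<le> f x)" "\<not> (AE x in M. f x < \<alpha>)"
    using ae_constant_if_no_level_splits by blast
  have "0 < \<alpha>"
  proof (rule ccontr)
    assume "\<not> 0 < \<alpha>"
    then have "\<alpha> \<le> f x" for x
      using f(2)[of x] by linarith
    with \<alpha>(1) show False by simp
  qed
  define g where "g = (\<lambda>x. max 0 (min 1 (\<bar>f x\<bar> / \<alpha>)))"
  have g: "g \<in> D" "g \<in> unit_on M {x \<in> space M. \<alpha> \<le> \<bar>f x\<bar>}"
    using unit_on_bump[OF f(1) \<open>0 < \<alpha>\<close>] by (auto simp: g_def)
  have "\<not> (AE x in M. \<bar>f x\<bar> < \<alpha>)"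
    using \<alpha>(2) f(2) by simp
  note 1 = one_equilibrium[OF const f(1) \<open>0 < \<alpha>\<close> this g]
  have one: "(\<lambda>x. 1) \<in> D"
    and pos: "\<And>\<psi>. \<psi> \<in> D \<Longrightarrow> (\<And>x. 0 \<le> \<psi> x) \<Longrightarrow> 0 \<le> bilin E (\<lambda>x. 1) \<psi>"
    using 1(1) by (auto simp: superharmonic_def)
  define k where "k = (\<lambda>x. 1 - g x)"
  have k: "k \<in> D"
    unfolding k_def by (intro D_diff one g)
  have k_bounds: "0 \<le> k x" for x
    by (auto simp: k_def g_def)
  have bilin_k: "bilin E (\<lambda>x. 1) k \<le> 0"
    unfolding k_def using bilin_diff[OF one one g(1)] bilin_self[OF one] 1(2) by simp
  \<comment> \<open>\<open>k\<close> vanishes only where \<open>f x \<ge> \<alpha>\<close>, which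
    fails on a set that is not null. Hence some level set of \<open>k\<close> is not null and
    \<open>one_equilibrium\<close> applies to \<open>k\<close> too.\<close>
  obtain N where N: "\<not> (AE x in M. \<bar>k x\<bar> < inverse (real (Suc N)))"
  proof (rule ccontr)
    assume "\<not> thesis"
    then have "AE x in M. \<bar>k x\<bar> < inverse (real (Suc N))" for N
      using that by blast
    then have "AE x in M. \<forall>N. \<bar>k x\<bar> < inverse (real (Suc N))"
      by (simp add: AE_all_countable)
    then have "AE x in M. \<alpha> \<le> f x"
    proof eventually_elim
      case (elim x)
      have "\<not> 0 < \<bar>k x\<bar>"
        using elim reals_Archimedean by (meson less_asym)
      then have "g x = 1"
        by (simp add: k_def)
      then have "1 \<le> \<bar>f x\<bar> / \<alpha>"
        by (auto simp: g_def max_def min_def split: if_splits)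
      with \<open>0 < \<alpha>\<close> f(2)[of x] show ?case
        by simp
    qed
    with \<alpha>(1) show False ..
  qed
  let ?\<epsilon> = "inverse (real (Suc N))"
  define k' where "k' = (\<lambda>x. max 0 (min 1 (\<bar>k x\<bar> / ?\<epsilon>)))"
  have \<epsilon>: "0 < ?\<epsilon>"
    by simp
  have k': "k' \<in> D" "k' \<in> unit_on M {x \<in> space M. ?\<epsilon> \<le> \<bar>k x\<bar>}"
    using unit_on_bump[OF k \<epsilon>] by (auto simp: k'_def)
  have "e (\<lambda>x. 1) \<le> bilin E (\<lambda>x. 1) k'"
    by (rule one_equilibrium(2)[OF const k \<epsilon> N k'])
  \<comment> \<open>\<open>k'\<close> is \<open>(N + 1) * k\<close> cut at 1 and hence lies below
    it; pairing with the superharmonic function 1 preserves this order.\<close>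
  also have "\<dots> \<le> bilin E (\<lambda>x. 1) (\<lambda>x. real (Suc N) * k x)"
  proof -
    have "0 \<le> real (Suc N) * k x - k' x" for x
      using k_bounds[of x] by (simp add: k'_def divide_inverse mult.commute)
    then have "0 \<le> bilin E (\<lambda>x. 1) (\<lambda>x. real (Suc N) * k x - k' x)"
      by (intro pos D_diff D_scale k k')
    then show ?thesis
      using bilin_diff[OF one D_scale[OF k] k'(1), of "real (Suc N)"] by simp
  qed
  also have "\<dots> = real (Suc N) * bilin E (\<lambda>x. 1) k"
    using one k by (rule bilin_of_nat)
  also have "\<dots> \<le> 0"
    using bilin_k by (intro mult_nonneg_nonpos) auto
  finally have "E (\<lambda>x. 1) = 0"
    by (subst E_eq[OF one]) (simp add: ennreal_eq_0_iff)
  then show ?thesis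
    by (simp add: recurrent_def form_kernel_def L0_const)
qed

end

theorem theorem2p64:
  fixes M :: "'a measure" and E :: "('a \<Rightarrow> real) \<Rightarrow> ennreal"
  assumes "localizable M"
    and "energy_form M E"
    and "full_support M E"
  shows "(recurrent M E \<longleftrightarrow> (\<forall>h. excessive M E h \<longrightarrow> h \<in> form_kernel M E)) \<and>
    (irreducible_form M E \<and> (\<exists>f\<in>form_domain M E. \<not> ae_constant M f) \<longrightarrow>
      (recurrent M E \<longleftrightarrow> (\<forall>h. excessive M E h \<longrightarrow> ae_constant M h)) \<and>
      ((\<forall>h. excessive M E h \<longrightarrow> h \<in> form_kernel M E) \<longleftrightarrow>
        (\<forall>h. excessive M E h \<longrightarrow> ae_constant M h)))"
proof -
  interpret L0_energy_form M E
    using assms by unfold_locales (auto simp: localizable_def energy_form_def)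
  have i_ii: "recurrent M E \<longleftrightarrow> (\<forall>h. excessive M E h \<longrightarrow> h \<in> form_kernel M E)"
    using recurrent_excessive_kernel one_excessive[OF assms(3)] by (auto simp: recurrent_def)
  moreover have "recurrent M E \<longleftrightarrow> (\<forall>h. excessive M E h \<longrightarrow> ae_constant M h)"
    if "irreducible_form M E" "\<exists>f\<in>form_domain M E. \<not> ae_constant M f"
    using that recurrent_excessive_kernel recurrent_irreducible_kernel_constant
      recurrent_if_excessive_constant by blast
  ultimately show ?thesis
    by blast
qed

end
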